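(* Let $\mathbb{X}$ be a Feller process in a Polish space $E$ with semigroup $(S_t)_{t\ge0}$. Assume that $\rho$ is a metric and that $\mathbb{X}$ acts as a contraction for the distance $\rho$. Then the fact that the generalized coupling time $h$ is bounded by (a constant multiple of) the metric $\rho$ is equivalent to the fact that the semigroup $(S_t)$ is exponentially contracting. More precisely, for $\alpha>1$ arbitrary and constants $M,T>0$: (a) if $h(x,y)\le M\rho(x,y)$ for all $x,y\in E$, then $\|S_t\|_{Lip}\le \frac1\alpha$ for all $t\ge M\alpha$; (b) if $\|S_T\|_{Lip}\le\frac1\alpha$, then $h(x,y)\le \frac{\alpha T}{\alpha-1}\rho(x,y)$ for all $x,y\in E$.
   Context: $\rho:E\times E\to[0,\infty]$ is a lower semi-continuous semi-metric (symmetric, zero on the diagonal, satisfying the triangle inequality), here assumed to be a metric. For $f:E\to\mathbb{R}$, $\|f\|_{Lip}:=\inf\{r\ge0: f(x)-f(y)\le r\rho(x,y)\ \forall x,y\in E\}$, and $\|S_t\|_{Lip}:=\sup_{\|f\|_{Lip}=1}\|S_tf\|_{Lip}$, where $S_tf(x)=\mathbb{E}_xf(X_t)$. The optimal coupling distance at time $t$ is $\rho_t(x,y):=\inf_{\pi}\int\rho(x',y')\,\pi(dx'dy')$, where the infimum ranges over all couplings $\pi$ of the marginals $\delta_xS_t$ and $\delta_yS_t$, the distributions of $X_t$ started from $x$ and $y$ respectively. The generalized coupling time is $h(x,y):=\int_0^\infty\rho_t(x,y)\,dt$. The process acts as a contraction for the distance $\rho$ if $\rho_t(x,y)\le\rho(x,y)$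 for all $t\ge0$ and $x,y\in E$, or equivalently $\|S_t\|_{Lip}\le1$ for all $t\ge0$. *)

theory Defs
  imports "HOL-Probability.Probability"
begin

section \<open>Extended metrics and Lipschitz norms\<close>

text \<open>
  The distance takes values in \<open>[0,\<infinity>]\<close>. It need not generate (or be related to, beyond
  lower semicontinuity) the topology of the Polish space.
\<close>

definition ext_semimetric :: "('e \<Rightarrow> 'e \<Rightarrow> ennreal) \<Rightarrow> bool" where
  "ext_semimetric \<rho> \<longleftrightarrow>
     (\<forall>x. \<rho> x x = 0) \<and> (\<forall>x y. \<rho> x y = \<rho> y x) \<and> (\<forall>x y z. \<rho> x z \<le> \<rho> x y + \<rho> y z)"

definition ext_metric :: "('e \<Rightarrow> 'e \<Rightarrow> ennreal) \<Rightarrow> bool" where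
  "ext_metric \<rho> \<longleftrightarrow> ext_semimetric \<rho> \<and> (\<forall>x y. \<rho> x y = 0 \<longrightarrow> x = y)"

definition lower_semicontinuous :: "('a::topological_space \<Rightarrow> 'b::linorder) \<Rightarrow> bool" where
  "lower_semicontinuous g \<longleftrightarrow> (\<forall>c. open {z. c < g z})"

text \<open>
  In \<open>lip_norm\<close>, \<open>ennreal\<close> truncates negative differences to \<open>0\<close>; this is harmless, since
  \<open>f x - f y \<le> r \<rho>(x,y)\<close> holds trivially when the left-hand side is negative. The infimum
  of the empty set is \<open>\<infinity>\<close>.
\<close>

definition lip_norm :: "('e \<Rightarrow> 'e \<Rightarrow> ennreal) \<Rightarrow> ('e \<Rightarrow> real) \<Rightarrow> ennreal" where
  "lip_norm \<rho> f =
     Inf {ennreal r | r. 0 \<le> r \<and> (\<forall>x y. ennreal (f x - f y) \<le> ennreal r * \<rho> x y)}"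

section \<open>Feller processes\<close>

text \<open>
  A process is a family of laws \<open>P x\<close> on a measurable space \<open>\<Omega>\<close>, indexed by the starting
  point, together with the coordinates \<open>X t\<close>, of which only those with \<open>t \<ge> 0\<close> are relevant.
\<close>

definition transition_semigroup :: "('e \<Rightarrow> 'w measure) \<Rightarrow> (real \<Rightarrow> 'w \<Rightarrow> 'e) \<Rightarrow> real \<Rightarrow> ('e \<Rightarrow> real) \<Rightarrow> 'e \<Rightarrow> real"
  where "transition_semigroup P X t f x = (\<integral>\<omega>. f (X t \<omega>) \<partial>P x)"

definition law :: "('e::topological_space \<Rightarrow> 'w measure) \<Rightarrow> (real \<Rightarrow> 'w \<Rightarrow> 'e) \<Rightarrow> real \<Rightarrow> 'e \<Rightarrow> 'e measure"
  where "law P X t x = distr (P x) borel (X t)"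

definition natural_filtration ::
    "'w measure \<Rightarrow> (real \<Rightarrow> 'w \<Rightarrow> 'e::topological_space) \<Rightarrow> real \<Rightarrow> 'w measure" where
  "natural_filtration \<Omega> X s =
     sigma (space \<Omega>) {X u -` A \<inter> space \<Omega> | u A. 0 \<le> u \<and> u \<le> s \<and> A \<in> sets borel}"

definition cadlag :: "(real \<Rightarrow> 'e::topological_space) \<Rightarrow> bool" where
  "cadlag p \<longleftrightarrow>
     (\<forall>t\<ge>0. (p \<longlongrightarrow> p t) (at_right t)) \<and> (\<forall>t>0. \<exists>l. (p \<longlongrightarrow> l) (at_left t))"

text \<open>
  As \<open>E\<close> is only assumed Polish (not locally compact), the Feller property is the preservation
  of bounded continuous functions. Continuity of \<open>t \<mapsto> S\<^sub>t f(x)\<close> from the right for such \<open>f\<close>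
  is a consequence of the paths being cadlag.
\<close>

locale feller_process =
  fixes \<Omega> :: "'w measure"
    and P :: "'e::polish_space \<Rightarrow> 'w measure"
    and X :: "real \<Rightarrow> 'w \<Rightarrow> 'e"
  assumes kernel: "P \<in> borel \<rightarrow>\<^sub>M prob_algebra \<Omega>"
    and X_measurable: "\<And>t. 0 \<le> t \<Longrightarrow> X t \<in> \<Omega> \<rightarrow>\<^sub>M borel"
    and paths: "\<And>\<omega>. \<omega> \<in> space \<Omega> \<Longrightarrow> cadlag (\<lambda>t. X t \<omega>)"
    and start: "\<And>x. AE \<omega> in P x. X 0 \<omega> = x"
    and markov: "\<And>x s t f. \<lbrakk>0 \<le> s; 0 \<le> t; f \<in> borel_measurable borel; bounded (range f)\<rbrakk> \<Longrightarrow>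
        AE \<omega> in P x. real_cond_exp (P x) (natural_filtration \<Omega> X s) (\<lambda>\<omega>. f (X (s + t) \<omega>)) \<omega>
          = transition_semigroup P X t f (X s \<omega>)"
    and feller: "\<And>t f. \<lbrakk>0 \<le> t; continuous_on UNIV f; bounded (range f)\<rbrakk> \<Longrightarrow>
        continuous_on UNIV (transition_semigroup P X t f)"

text \<open>
  The supremum defining \<open>\<parallel>S\<^sub>t\<parallel>\<close> ranges over those \<open>f\<close> for which \<open>S\<^sub>t f\<close> is defined: a function
  that is Lipschitz for \<open>\<rho>\<close> need be neither Borel measurable nor integrable, and the Bochner
  integral would silently be \<open>0\<close>.
\<close>

definition semigroup_lip_norm ::
    "('e::topological_space \<Rightarrow> 'e \<Rightarrow> ennreal) \<Rightarrow> ('e \<Rightarrow> 'w measure) \<Rightarrow> (real \<Rightarrow> 'w \<Rightarrow> 'e) \<Rightarrow> real \<Rightarrow> ennreal"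
  where
  "semigroup_lip_norm \<rho> P X t =
     Sup {lip_norm \<rho> (transition_semigroup P X t f) | f.
            f \<in> borel_measurable borel \<and> (\<forall>x. integrable (P x) (\<lambda>\<omega>. f (X t \<omega>))) \<and> lip_norm \<rho> f = 1}"

text \<open>The constant \<open>C\<close> is not required to be \<open>1\<close>.\<close>

definition exponentially_contracting ::
    "('e::topological_space \<Rightarrow> 'e \<Rightarrow> ennreal) \<Rightarrow> ('e \<Rightarrow> 'w measure) \<Rightarrow> (real \<Rightarrow> 'w \<Rightarrow> 'e) \<Rightarrow> bool"
  where
  "exponentially_contracting \<rho> P X \<longleftrightarrow>
     (\<exists>C>0. \<exists>c>0. \<forall>t\<ge>0. semigroup_lip_norm \<rho> P X t \<le> ennreal (C * exp (- c * t)))"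

section \<open>Optimal couplings\<close>

definition couplings :: "'e::topological_space measure \<Rightarrow> 'e measure \<Rightarrow> ('e \<times> 'e) measure set" where
  "couplings \<mu> \<nu> =
     {\<pi>. sets \<pi> = sets (borel \<Otimes>\<^sub>M borel) \<and> distr \<pi> borel fst = \<mu> \<and> distr \<pi> borel snd = \<nu>}"

definition coupling_distance ::
    "('e::topological_space \<Rightarrow> 'e \<Rightarrow> ennreal) \<Rightarrow> ('e \<Rightarrow> 'w measure) \<Rightarrow> (real \<Rightarrow> 'w \<Rightarrow> 'e) \<Rightarrow> real \<Rightarrow> 'e \<Rightarrow> 'e \<Rightarrow> ennreal"
  where
  "coupling_distance \<rho> P X t x y =
     (INF \<pi>\<in>couplings (law P X t x) (law P X t y). \<integral>\<^sup>+z. \<rho> (fst z) (snd z) \<partial>\<pi>)"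

text \<open>
  Under contraction, \<open>t \<mapsto> \<rho>\<^sub>t(x,y)\<close> is nonincreasing, hence measurable, so the integral below is
  a genuine one where it is used.
\<close>

definition generalized_coupling_time ::
    "('e::topological_space \<Rightarrow> 'e \<Rightarrow> ennreal) \<Rightarrow> ('e \<Rightarrow> 'w measure) \<Rightarrow> (real \<Rightarrow> 'w \<Rightarrow> 'e) \<Rightarrow> 'e \<Rightarrow> 'e \<Rightarrow> ennreal"
  where
  "generalized_coupling_time \<rho> P X x y =
     (\<integral>\<^sup>+t\<in>{0..}. coupling_distance \<rho> P X t x y \<partial>lborel)"

definition acts_as_contraction ::
    "('e::topological_space \<Rightarrow> 'e \<Rightarrow> ennreal) \<Rightarrow> ('e \<Rightarrow> 'w measure) \<Rightarrow> (real \<Rightarrow> 'w \<Rightarrow> 'e) \<Rightarrow> bool"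
  where
  "acts_as_contraction \<rho> P X \<longleftrightarrow> (\<forall>t\<ge>0. \<forall>x y. coupling_distance \<rho> P X t x y \<le> \<rho> x y)"

end

theory Submission
  imports Defs
begin

text \<open>
  Write \<open>d\<^sub>t = \<parallel>S\<^sub>t\<parallel>\<close> for the Lipschitz norm of the semigroup. Everything rests on the equivalence, for
  \<open>r > 0\<close>, of \<open>d\<^sub>t \<le> r\<close> and \<open>\<rho>\<^sub>t \<le> r \<rho>\<close>. That \<open>\<rho>\<^sub>t \<le> r \<rho>\<close> gives \<open>d\<^sub>t \<le> r\<close> is immediate: the
  difference \<open>S\<^sub>t f(x) - S\<^sub>t f(y)\<close> is the integral of \<open>f(x') - f(y')\<close> against any coupling of the two
  laws. The converse is Kantorovich-Rubinstein duality for lower semicontinuous, possibly infinite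
  costs.

  For (a), let \<open>f\<close> be \<open>1\<close>-Lipschitz and \<open>0 \<le> s \<le> t\<close>. By contraction \<open>S\<^sub>t\<^sub>-\<^sub>s f\<close> is \<open>1\<close>-Lipschitz, so
  \<open>S\<^sub>t f(x) - S\<^sub>t f(y) \<le> \<rho>\<^sub>s(x,y)\<close>; integrating over \<open>s \<in> [0,t]\<close> gives
  \<open>t (S\<^sub>t f(x) - S\<^sub>t f(y)) \<le> h(x,y) \<le> M \<rho>(x,y)\<close>, that is \<open>d\<^sub>t \<le> M/t\<close>
  (\<open>contracts_of_coupling_time_bound\<close>).

  For (b), the semigroup property and contraction give \<open>d\<^sub>t \<le> \<alpha>\<^sup>-\<^sup>k\<close> for \<open>t \<ge> k T\<close>. The hard half of the
  duality turns this into \<open>\<rho>\<^sub>t \<le> \<alpha>\<^sup>-\<^sup>k \<rho>\<close>, and the geometric series \<open>\<Sum>\<^sub>k T \<alpha>\<^sup>-\<^sup>k\<close> bounds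
  \<open>h\<close> by \<open>\<alpha> T / (\<alpha> - 1) \<rho>\<close> (\<open>coupling_time_le_of_contracts\<close>). The equivalence with exponential
  contraction follows from (a) with \<open>\<alpha> = 2\<close>, iterated, and from (b) at a time at which the exponential
  bound is at most \<open>1/2\<close>.

  The duality (\<open>kantorovich_rubinstein_coupling\<close>) is proved by discretization. A countable base
  \<open>U\<^sub>0, U\<^sub>1, \<dots>\<close> splits the space, at level \<open>n\<close>, into the finitely many cells on which the memberships in
  \<open>U\<^sub>0, \<dots>, U\<^sub>n\<^sub>-\<^sub>1\<close> are fixed; the cost between two cells is the infimum of \<open>min n \<rho>\<close> over their product.
  These finite transport problems are solved exactly by the Farkas lemma
  (\<open>finite_transport_duality\<close>), since every admissible pair of finite potentials can be replaced, up to
  \<open>\<epsilon>\<close>, by one bounded Borel function that is \<open>1\<close>-Lipschitz for \<open>\<rho>\<close> (\<open>simple_dual_bound\<close>). A subsequence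
  of the finite plans converges on all cells to the law of a pair of random bit sequences
  (\<open>subsequence_limit_of_bits\<close>); decoding the bits gives random points with the prescribed marginals
  (\<open>decode_law\<close>). The cell costs increase to \<open>\<rho>\<close> precisely because \<open>\<rho>\<close> is lower semicontinuous
  (\<open>SUP_cell_cost\<close>), so monotone convergence bounds the cost of this coupling.
\<close>

section \<open>Finite optimal transport\<close>

definition linear_functional :: "(('i \<Rightarrow> real) \<Rightarrow> real) \<Rightarrow> bool" where
  "linear_functional g \<longleftrightarrow> (\<forall>x y a. g (\<lambda>i. x i + a * y i) = g x + a * g y)"

lemma linear_functionalD:
  "linear_functional g \<Longrightarrow> g (\<lambda>i. x i + a * y i) = g x + a * g y"
  by (auto simp: linear_functional_def)

lemma linear_functional_zero:
  assumes "linear_functional g"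
  shows "g (\<lambda>i. 0) = 0"
  using linear_functionalD[OF assms, of "\<lambda>i. 0" 1 "\<lambda>i. 0"] by simp

lemma linear_functional_scale:
  assumes "linear_functional g"
  shows "g (\<lambda>i. a * x i) = a * g x"
  using linear_functionalD[OF assms, of "\<lambda>i. 0" a x] linear_functional_zero[OF assms] by simp

text \<open>
  Bartl's induction on the number of constraints. If the constraints in \<open>A\<close> alone do not force
  \<open>f \<le> 0\<close>, some \<open>v\<close> satisfies them with \<open>f v > 0\<close>, hence violates the remaining constraint \<open>g b\<close>.
  After normalizing \<open>g b v = 1\<close>, projecting along \<open>v\<close> onto the kernel of \<open>g b\<close> removes that constraint,
  and the multiplier of \<open>g b\<close> can be read off at \<open>v\<close>.
\<close>

lemma farkas:
  assumes "finite A" "\<And>a. a \<in> A \<Longrightarrow> linear_functional (g a)" "linear_functional f"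
    and "\<And>x. (\<And>a. a \<in> A \<Longrightarrow> g a x \<le> 0) \<Longrightarrow> f x \<le> 0"
  shows "\<exists>l. (\<forall>a\<in>A. 0 \<le> l a) \<and> (\<forall>x. f x = (\<Sum>a\<in>A. l a * g a x))"
  using assms
proof (induction A arbitrary: f g rule: finite_induct)
  case empty
  have "f x = 0" for x
    using empty(3)[of x] empty(3)[of "\<lambda>i. (-1) * x i"]
      linear_functional_scale[OF empty(2), of "-1" x] by simp
  then show ?case by simp
next
  case (insert b A)
  have lin: "linear_functional (g a)" if "a \<in> insert b A" for a
    using insert.prems(1) that by blast
  show ?case
  proof (cases "\<forall>x. (\<forall>a\<in>A. g a x \<le> 0) \<longrightarrow> f x \<le> 0")
    case True
    then obtain l where l: "\<forall>a\<in>A. 0 \<le> l a" "\<forall>x. f x = (\<Sum>a\<in>A. l a * g a x)"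
      using insert.IH[of g f] insert.prems(2) lin by blast
    have "(\<Sum>a\<in>insert b A. (l(b := 0)) a * g a x) = (\<Sum>a\<in>A. l a * g a x)" for x
      using insert.hyps by (auto intro!: sum.cong)
    then show ?thesis
      using l by (intro exI[of _ "l(b := 0)"]) auto
  next
    case False
    then obtain w where w: "\<And>a. a \<in> A \<Longrightarrow> g a w \<le> 0" "f w > 0" by force
    have gbw: "g b w > 0"
      using insert.prems(3)[of w] w by force
    define v where "v = (\<lambda>i. (1 / g b w) * w i)"
    have scale_v: "h v = h w / g b w" if "linear_functional h" for h
      using linear_functional_scale[OF that, of "1 / g b w" w] by (simp add: v_def)
    have v: "g b v = 1" "f v > 0" "\<And>a. a \<in> A \<Longrightarrow> g a v \<le> 0"
      using scale_v[OF lin] scale_v[OF insert.prems(2)] gbw w by (auto intro: divide_nonpos_pos)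
    define pr where "pr = (\<lambda>x i. x i + (- g b x) * v i)"
    have pr: "h (pr x) = h x - g b x * h v" if "linear_functional h" for h x
      using linear_functionalD[OF that, of x "- g b x" v] by (simp add: pr_def)
    have lin_pr: "linear_functional (\<lambda>x. h (pr x))" if h: "linear_functional h" for h
      using linear_functionalD[OF h] linear_functionalD[OF lin[of b]]
      by (simp add: linear_functional_def pr[OF h] algebra_simps)
    have "\<exists>l. (\<forall>a\<in>A. 0 \<le> l a) \<and> (\<forall>x. f (pr x) = (\<Sum>a\<in>A. l a * g a (pr x)))"
    proof (rule insert.IH)
      fix x assume *: "\<And>a. a \<in> A \<Longrightarrow> g a (pr x) \<le> 0"
      have "g b (pr x) = 0" using pr[OF lin[of b]] v by simp
      with * show "f (pr x) \<le> 0" by (intro insert.prems(3)) auto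
    qed (use lin insert.prems lin_pr in auto)
    then obtain l where l: "\<And>a. a \<in> A \<Longrightarrow> 0 \<le> l a"
      "\<And>x. f (pr x) = (\<Sum>a\<in>A. l a * g a (pr x))" by blast
    define lb where "lb = f v - (\<Sum>a\<in>A. l a * g a v)"
    have "(\<Sum>a\<in>A. l a * g a v) \<le> 0"
      using l(1) v(3) by (intro sum_nonpos) (auto simp: mult_nonneg_nonpos)
    then have lb: "lb \<ge> 0" using v by (simp add: lb_def)
    have "f x = (\<Sum>a\<in>insert b A. (l(b := lb)) a * g a x)" for x
    proof -
      have "f x = g b x * f v + (\<Sum>a\<in>A. l a * g a (pr x))"
        using l(2)[of x] pr[OF insert.prems(2), of x] by simp
      also have "(\<Sum>a\<in>A. l a * g a (pr x)) = (\<Sum>a\<in>A. l a * g a x - g b x * (l a * g a v))"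
        using lin by (intro sum.cong) (auto simp: pr algebra_simps)
      also have "\<dots> = (\<Sum>a\<in>A. l a * g a x) - g b x * (\<Sum>a\<in>A. l a * g a v)"
        by (simp add: sum_subtractf sum_distrib_left)
      finally have "f x = lb * g b x + (\<Sum>a\<in>A. l a * g a x)"
        by (simp add: lb_def algebra_simps)
      also have "(\<Sum>a\<in>A. l a * g a x) = (\<Sum>a\<in>A. (l(b := lb)) a * g a x)"
        using insert.hyps by (intro sum.cong) auto
      finally show ?thesis using insert.hyps by simp
    qed
    then show ?thesis
      using lb l(1) insert.hyps by (intro exI[of _ "l(b := lb)"]) auto
  qed
qed

text \<open>
  Farkas' lemma on the homogenized dual problem: a vector consists of the potentials \<open>\<phi>\<close>, \<open>\<psi>\<close> and a
  scaling variable (the coordinate \<open>None\<close>), constrained by \<open>\<phi> i + \<psi> j \<le> s c i j\<close> and \<open>s \<ge> 0\<close>. The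
  multipliers of the constraints \<open>(i, j)\<close> form the plan, and the equality of linear functionals,
  evaluated at unit vectors, says that the plan has the right marginals and that its cost is at
  most \<open>L\<close>.
\<close>

lemma finite_transport_duality:
  fixes A :: "'i pmf" and B :: "'j pmf" and c :: "'i \<Rightarrow> 'j \<Rightarrow> real"
  assumes fin: "finite I" "finite J" and supp: "set_pmf A \<subseteq> I" "set_pmf B \<subseteq> J"
    and c: "\<And>i j. 0 \<le> c i j"
    and dual: "\<And>\<phi> \<psi>. (\<And>i j. i \<in> I \<Longrightarrow> j \<in> J \<Longrightarrow> \<phi> i + \<psi> j \<le> c i j) \<Longrightarrow>
      measure_pmf.expectation A \<phi> + measure_pmf.expectation B \<psi> \<le> L"
  shows "\<exists>q. map_pmf fst q = A \<and> map_pmf snd q = B \<and>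
    measure_pmf.expectation q (\<lambda>z. c (fst z) (snd z)) \<le> L"
proof -
  have EA: "measure_pmf.expectation A \<phi> = (\<Sum>i\<in>I. pmf A i * \<phi> i)" for \<phi> :: "'i \<Rightarrow> real"
    using integral_measure_pmf_real[OF fin(1), of A \<phi>] supp by (auto simp: mult.commute)
  have EB: "measure_pmf.expectation B \<phi> = (\<Sum>i\<in>J. pmf B i * \<phi> i)" for \<phi> :: "'j \<Rightarrow> real"
    using integral_measure_pmf_real[OF fin(2), of B \<phi>] supp by (auto simp: mult.commute)
  define C where "C = insert None (Some ` (I \<times> J))"
  define g where "g = (\<lambda>k (v :: ('i + 'j) option \<Rightarrow> real). case k of None \<Rightarrow> - v None
    | Some (i, j) \<Rightarrow> v (Some (Inl i)) + v (Some (Inr j)) - v None * c i j)"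
  define f where "f = (\<lambda>v :: ('i + 'j) option \<Rightarrow> real.
    (\<Sum>i\<in>I. pmf A i * v (Some (Inl i))) + (\<Sum>j\<in>J. pmf B j * v (Some (Inr j))) - L * v None)"
  have sum_C: "(\<Sum>k\<in>C. l k * g k v) = - l None * v None + (\<Sum>(i, j)\<in>I \<times> J.
      l (Some (i, j)) * (v (Some (Inl i)) + v (Some (Inr j)) - v None * c i j))" for l v
    using fin by (simp add: C_def g_def sum.reindex case_prod_beta)
  have "\<exists>l. (\<forall>k\<in>C. 0 \<le> l k) \<and> (\<forall>v. f v = (\<Sum>k\<in>C. l k * g k v))"
  proof (rule farkas)
    show "finite C" using fin by (simp add: C_def)
    show "linear_functional (g k)" for k
      by (cases k) (auto simp: linear_functional_def g_def algebra_simps)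
    show "linear_functional f"
      by (simp add: linear_functional_def f_def algebra_simps sum.distrib sum_distrib_left)
    fix v assume v: "\<And>k. k \<in> C \<Longrightarrow> g k v \<le> 0"
    have s: "0 \<le> v None" using v[of None] by (simp add: C_def g_def)
    have le: "v (Some (Inl i)) + v (Some (Inr j)) \<le> v None * c i j" if "i \<in> I" "j \<in> J" for i j
      using v[of "Some (i, j)"] that by (simp add: C_def g_def)
    define F where "F = (\<Sum>i\<in>I. pmf A i * v (Some (Inl i))) + (\<Sum>j\<in>J. pmf B j * v (Some (Inr j)))"
    have sc: "a * F \<le> L" if a: "0 \<le> a" "a * v None \<le> 1" for a
    proof -
      have "(a * v (Some (Inl i))) + (a * v (Some (Inr j))) \<le> c i j" if ij: "i \<in> I" "j \<in> J" for i j
      proof -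
        have "a * (v (Some (Inl i)) + v (Some (Inr j))) \<le> a * (v None * c i j)"
          using le[OF ij] a by (intro mult_left_mono) auto
        also have "\<dots> = (a * v None) * c i j" by simp
        also have "\<dots> \<le> 1 * c i j" using a c by (intro mult_right_mono) auto
        finally show ?thesis by (simp add: algebra_simps)
      qed
      from dual[of "\<lambda>i. a * v (Some (Inl i))" "\<lambda>j. a * v (Some (Inr j))", OF this]
      show ?thesis unfolding EA EB F_def
        by (simp add: algebra_simps sum_distrib_left)
    qed
    (* For v None = 0 every positive multiple of the potentials is admissible. *)
    have "F \<le> L * v None"
    proof (cases "v None = 0")
      case True
      show ?thesis
      proof (rule ccontr)
        assume "\<not> ?thesis"
        then have F: "F > 0" using True by simp
        have "(\<bar>L\<bar> + 1) / F * F \<le> L" by (rule sc) (use F True in auto)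
        with F show False by simp
      qed
    next
      case False
      then show ?thesis using sc[of "1 / v None"] s by (simp add: field_simps)
    qed
    then show "f v \<le> 0" by (simp add: f_def F_def)
  qed
  then obtain l where l: "\<And>k. k \<in> C \<Longrightarrow> 0 \<le> l k" "\<And>v. f v = (\<Sum>k\<in>C. l k * g k v)" by blast
  define p where "p = (\<lambda>z. if z \<in> I \<times> J then l (Some z) else 0)"
  have p0: "0 \<le> p z" for z using l(1) by (auto simp: p_def C_def)
  have f_eq: "f v = - l None * v None + (\<Sum>i\<in>I. \<Sum>j\<in>J.
      p (i, j) * (v (Some (Inl i)) + v (Some (Inr j)) - v None * c i j))" for v
    unfolding l(2) sum_C by (simp add: sum.cartesian_product p_def case_prod_beta cong: sum.cong)
  (* Unit vectors at a first potential, at a second potential and at the scaling variable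
     isolate the row sums, the column sums and the cost. *)
  have rowA: "(\<Sum>j\<in>J. p (i, j)) = pmf A i" if "i \<in> I" for i
  proof -
    have "f (\<lambda>k. if k = Some (Inl i) then 1 else 0) = pmf A i"
      using that fin by (simp add: f_def if_distrib sum.delta' cong: if_cong)
    moreover have "f (\<lambda>k. if k = Some (Inl i) then 1 else 0) = (\<Sum>i'\<in>I. if i = i' then (\<Sum>j\<in>J. p (i', j)) else 0)"
      unfolding f_eq by (auto intro!: sum.cong)
    ultimately show ?thesis using that fin by simp
  qed
  have colB: "(\<Sum>i\<in>I. p (i, j)) = pmf B j" if "j \<in> J" for j
  proof -
    have "f (\<lambda>k. if k = Some (Inr j) then 1 else 0) = pmf B j"
      using that fin by (simp add: f_def if_distrib sum.delta' cong: if_cong)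
    moreover have "f (\<lambda>k. if k = Some (Inr j) then 1 else 0) = (\<Sum>i\<in>I. \<Sum>j'\<in>J. if j = j' then p (i, j') else 0)"
      unfolding f_eq by (auto intro!: sum.cong)
    ultimately show ?thesis using that fin by simp
  qed
  have cost: "(\<Sum>z\<in>I\<times>J. p z * c (fst z) (snd z)) \<le> L"
  proof -
    have "f (\<lambda>k. if k = None then 1 else 0) = - L" by (simp add: f_def)
    moreover have "f (\<lambda>k. if k = None then 1 else 0) = - l None - (\<Sum>i\<in>I. \<Sum>j\<in>J. p (i, j) * c i j)"
      unfolding f_eq by (simp add: sum_negf)
    moreover have "0 \<le> l None" using l(1) by (simp add: C_def)
    ultimately show ?thesis by (simp add: sum.cartesian_product case_prod_beta)
  qed
  have sumA: "(\<Sum>i\<in>I. pmf A i) = 1"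
    using supp fin by (simp add: sum_pmf_eq_1)
  have tot: "(\<Sum>z\<in>I\<times>J. p z) = 1"
    using rowA sumA by (simp add: sum.cartesian_product')
  have "(\<integral>\<^sup>+z. ennreal (p z) \<partial>count_space UNIV) = (\<integral>\<^sup>+z. ennreal (p z) \<partial>count_space (I\<times>J))"
    by (rule nn_integral_count_space_eq) (auto simp: p_def)
  also have "\<dots> = ennreal (\<Sum>z\<in>I\<times>J. p z)"
    using fin p0 by (simp add: nn_integral_count_space_finite sum_ennreal)
  finally have one: "(\<integral>\<^sup>+z. ennreal (p z) \<partial>count_space UNIV) = 1" using tot by simp
  define q where "q = embed_pmf p"
  have pq: "pmf q z = p z" for z unfolding q_def by (rule pmf_embed_pmf[OF p0 one])
  have supq: "set_pmf q \<subseteq> I \<times> J" by (auto simp: set_pmf_eq pq p_def split: if_splits)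
  have meas: "measure q S = (\<Sum>z\<in>I\<times>J. if z \<in> S then p z else 0)" for S
  proof -
    have "measure q S = measure q (S \<inter> (I \<times> J))"
      using supq by (intro measure_eq_AE) (auto simp: AE_measure_pmf_iff)
    also have "\<dots> = (\<Sum>z\<in>S \<inter> (I\<times>J). p z)"
      using fin by (subst measure_measure_pmf_finite) (auto simp: pq)
    also have "\<dots> = (\<Sum>z\<in>I\<times>J. if z \<in> S then p z else 0)"
      using fin by (subst sum.inter_filter[symmetric]) (auto intro!: sum.cong)
    finally show ?thesis .
  qed
  have "map_pmf fst q = A"
  proof (rule pmf_eqI)
    fix i
    have "pmf (map_pmf fst q) i = (\<Sum>i'\<in>I. if i' = i then \<Sum>j\<in>J. p (i', j) else 0)"
      unfolding pmf_map meas sum.cartesian_product' by (auto intro!: sum.cong)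
    then show "pmf (map_pmf fst q) i = pmf A i"
      using fin rowA supp by (auto simp: set_pmf_eq)
  qed
  moreover have "map_pmf snd q = B"
  proof (rule pmf_eqI)
    fix j
    have "pmf (map_pmf snd q) j = (\<Sum>i\<in>I. \<Sum>j'\<in>J. if j' = j then p (i, j') else 0)"
      unfolding pmf_map meas sum.cartesian_product' by (auto intro!: sum.cong)
    also have "\<dots> = (\<Sum>j'\<in>J. if j' = j then \<Sum>i\<in>I. p (i, j') else 0)"
      by (subst sum.swap) (auto intro!: sum.cong)
    finally show "pmf (map_pmf snd q) j = pmf B j"
      using fin colB supp by (auto simp: set_pmf_eq)
  qed
  moreover have "measure_pmf.expectation q (\<lambda>z. c (fst z) (snd z)) \<le> L"
    using cost supq fin
    by (subst integral_measure_pmf_real[of "I \<times> J"]) (auto simp: pq mult.commute)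
  ultimately show ?thesis by blast
qed

section \<open>Limits of laws of random bits\<close>

text \<open>
  The base-four digits \<open>1\<close> and \<open>2\<close> keep every tail of the expansion inside \<open>[1/3, 2/3]\<close>, away from
  the integers. Each digit therefore extends to a continuous function on the reals, as weak
  convergence requires.
\<close>

definition encode_bits :: "(nat \<Rightarrow> bool) \<Rightarrow> real" where
  "encode_bits x = (\<Sum>n. (if x n then 2 else 1) / 4 ^ Suc n)"

text \<open>
  Modulo four, \<open>4\<^sup>n\<^sup>+\<^sup>1 r\<close> lies in \<open>[4/3, 5/3]\<close> if digit \<open>n\<close> is \<open>1\<close> and in \<open>[7/3, 8/3]\<close> if it is \<open>2\<close>. On
  these intervals \<open>sin (\<pi> y / 2)\<close> is at least \<open>1/2\<close> and at most \<open>-1/2\<close>, respectively, so clamping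
  \<open>1/2 - sin (\<pi> y / 2)\<close> to \<open>[0, 1]\<close> returns the bit.
\<close>

definition detect_bit :: "nat \<Rightarrow> real \<Rightarrow> real" where
  "detect_bit n r = max 0 (min 1 (1/2 - sin (pi / 2 * (4 ^ Suc n * r))))"

lemma sums_quarter: "(\<lambda>n. c / 4 ^ Suc n) sums (c / 3 :: real)"
proof -
  have "(\<lambda>n. c / 4 * (1 / 4) ^ n) sums (c / 4 * (1 / (1 - 1 / 4)))"
    by (intro sums_mult geometric_sums) auto
  moreover have "c / 4 * (1 / (1 - 1 / 4)) = c / 3" by simp
  ultimately show ?thesis by (simp add: power_divide)
qed

lemma summable_encode_bits: "summable (\<lambda>n. (if x n then 2 else 1) / 4 ^ Suc n :: real)"
  by (rule summable_comparison_test'[OF sums_summable[OF sums_quarter[of 2]], of 0])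
    (auto intro!: divide_right_mono simp del: power_Suc)

lemma encode_bits_bounds: "1/3 \<le> encode_bits x" "encode_bits x \<le> 2/3"
proof -
  have "(\<Sum>n. 1 / 4 ^ Suc n) \<le> encode_bits x" unfolding encode_bits_def
    by (intro suminf_le summable_encode_bits sums_summable[OF sums_quarter]) (auto intro!: divide_right_mono simp del: power_Suc)
  then show "1/3 \<le> encode_bits x" using sums_unique[OF sums_quarter[of 1]] by simp
  have "encode_bits x \<le> (\<Sum>n. 2 / 4 ^ Suc n)" unfolding encode_bits_def
    by (intro suminf_le summable_encode_bits sums_summable[OF sums_quarter]) (auto intro!: divide_right_mono simp del: power_Suc)
  then show "encode_bits x \<le> 2/3" using sums_unique[OF sums_quarter[of 2]] by simp
qed

lemma encode_bits_shift:
  "4 * encode_bits x = (if x 0 then 2 else 1) + encode_bits (\<lambda>n. x (Suc n))"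
proof -
  have "encode_bits x = (if x 0 then 2 else 1) / 4 + (\<Sum>n. (if x (Suc n) then 2 else 1) / 4 ^ Suc (Suc n))"
    unfolding encode_bits_def using suminf_split_head[OF summable_encode_bits[of x]] by simp
  also have "(\<Sum>n. (if x (Suc n) then 2 else 1) / 4 ^ Suc (Suc n) :: real) = encode_bits (\<lambda>n. x (Suc n)) / 4"
    unfolding encode_bits_def using suminf_divide[OF summable_encode_bits[of "\<lambda>n. x (Suc n)"], of 4]
    by (simp add: field_simps)
  finally show ?thesis by simp
qed

lemma encode_bits_digit:
  "\<exists>k::int. 4 ^ Suc n * encode_bits x
     = 4 * of_int k + (if x n then 2 else 1) + encode_bits (\<lambda>i. x (i + Suc n))"
proof (induction n arbitrary: x)
  case 0
  show ?case using encode_bits_shift[of x] by (intro exI[of _ 0]) auto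
next
  case (Suc n)
  obtain k :: int where k: "4 ^ Suc n * encode_bits (\<lambda>i. x (Suc i))
     = 4 * of_int k + (if x (Suc n) then 2 else 1) + encode_bits (\<lambda>i. x (Suc (i + Suc n)))"
    using Suc[of "\<lambda>i. x (Suc i)"] by auto
  have "4 ^ Suc (Suc n) * encode_bits x = 4 ^ Suc n * (4 * encode_bits x)" by simp
  also have "\<dots> = 4 ^ Suc n * (if x 0 then 2 else 1) + 4 ^ Suc n * encode_bits (\<lambda>i. x (Suc i))"
    by (simp only: encode_bits_shift distrib_left)
  also have "\<dots> = 4 * (4 ^ n * (if x 0 then 2 else 1) + of_int k) + (if x (Suc n) then 2 else 1)
      + encode_bits (\<lambda>i. x (i + Suc (Suc n)))"
    unfolding k by (simp add: distrib_left)
  also have "4 ^ n * (if x 0 then 2 else 1) + real_of_int k = of_int (4 ^ n * (if x 0 then 2 else 1) + k)"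
    by simp
  finally show ?case by blast
qed

lemma detect_bit_encode_bits: "detect_bit n (encode_bits x) = (if x n then 1 else 0)"
proof -
  obtain k :: int where k: "4 ^ Suc n * encode_bits x
     = 4 * of_int k + (if x n then 2 else 1) + encode_bits (\<lambda>i. x (i + Suc n))"
    using encode_bits_digit[of n x] by blast
  define t where "t = encode_bits (\<lambda>i. x (i + Suc n))"
  define d :: real where "d = (if x n then 2 else 1)"
  have t: "1/3 \<le> t" "t \<le> 2/3" using encode_bits_bounds by (auto simp: t_def)
  have "pi / 2 * (4 ^ Suc n * encode_bits x) = pi / 2 * (d + t) + of_int k * (2 * pi)"
    unfolding k by (simp add: t_def d_def algebra_simps)
  then have s: "sin (pi / 2 * (4 ^ Suc n * encode_bits x)) = sin (pi / 2 * (d + t))"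
    using sin_int_2pin[of k] cos_int_2pin[of k] by (simp add: sin_add mult.commute)
  show ?thesis
  proof (cases "x n")
    case True
    have "pi / 2 * (d + t) = pi / 2 * t + pi" using True by (simp add: d_def field_simps)
    then have "sin (pi / 2 * (d + t)) = - sin (pi / 2 * t)" by (simp only: sin_periodic_pi)
    moreover have "sin (pi / 6) \<le> sin (pi / 2 * t)"
      using t by (intro sin_monotone_2pi_le) (auto simp: field_simps)
    ultimately show ?thesis using True s by (simp add: detect_bit_def sin_30)
  next
    case False
    have "pi / 2 * (d + t) = pi / 2 * t + pi / 2" using False by (simp add: d_def field_simps)
    then have "sin (pi / 2 * (d + t)) = cos (pi / 2 * t)" by (simp only: sin_add) simp
    moreover have "cos (pi / 3) \<le> cos (pi / 2 * t)"
      using t by (intro cos_monotone_0_pi_le) (auto simp: field_simps)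
    ultimately show ?thesis using False s by (simp add: detect_bit_def cos_60)
  qed
qed

lemma detect_bit_bounds: "0 \<le> detect_bit n r" "detect_bit n r \<le> 1"
  by (auto simp: detect_bit_def)

lemma isCont_detect_bit: "isCont (detect_bit n) r"
  unfolding detect_bit_def by (intro continuous_intros)

text \<open>
  Sequential compactness for laws of countably many random bits. The bits are encoded in one bounded
  real number, so Helly's theorem gives a weak limit along a subsequence. The bits are continuous
  functions of the code and take only the values \<open>0\<close> and \<open>1\<close>; the latter passes to the limit, and
  the probability of a finite pattern is the integral of a bounded continuous function.
\<close>

lemma subsequence_limit_of_bits:
  fixes Q :: "nat \<Rightarrow> 'z measure" and b :: "'i::countable \<Rightarrow> 'z \<Rightarrow> bool"
  assumes prob: "\<And>m. prob_space (Q m)" and meas: "\<And>m i. Measurable.pred (Q m) (b i)"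
  obtains r :: "nat \<Rightarrow> nat" and M :: "real measure" and b' :: "'i \<Rightarrow> real \<Rightarrow> bool"
  where "strict_mono r" "prob_space M" "\<And>i. Measurable.pred M (b' i)"
    and "\<And>J \<sigma>. finite J \<Longrightarrow>
      (\<lambda>k. measure (Q (r k)) {z \<in> space (Q (r k)). \<forall>i\<in>J. b i z = \<sigma> i})
        \<longlonglongrightarrow> measure M {\<omega> \<in> space M. \<forall>i\<in>J. b' i \<omega> = \<sigma> i}"
proof -
  define e where "e = (\<lambda>z. encode_bits (\<lambda>n. b (from_nat n) z))"
  note meas[measurable]
  have e_meas[measurable]: "e \<in> borel_measurable (Q m)" for m
    unfolding e_def encode_bits_def by measurable
  define R where "R = (\<lambda>m. distr (Q m) borel e)"
  have R: "real_distribution (R m)" for m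
    unfolding R_def by (rule prob_space.real_distribution_distr[OF prob e_meas])
  have "tight R" unfolding tight_def
  proof safe
    fix \<epsilon> :: real assume "\<epsilon> > 0"
    have "measure (R m) {0<..1} = 1" for m
    proof -
      interpret Q: prob_space "Q m" by (rule prob)
      have "0 < e z" "e z \<le> 1" for z
        using encode_bits_bounds[of "\<lambda>n. b (from_nat n) z"] by (auto simp: e_def)
      then have "e -` {0<..1} \<inter> space (Q m) = space (Q m)" by auto
      then show ?thesis unfolding R_def by (subst measure_distr) (auto simp: Q.prob_space)
    qed
    then show "\<exists>c d. c < d \<and> (\<forall>m. 1 - \<epsilon> < measure (R m) {c<..d})"
      using \<open>\<epsilon> > 0\<close> by (intro exI[of _ 0] exI[of _ 1]) auto
  qed (rule R)
  then obtain r M where r: "strict_mono r" and M: "real_distribution M"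
      and wc: "weak_conv_m (R \<circ> id \<circ> r) M"
    using tight_imp_convergent_subsubsequence[of R id] strict_mono_id by auto
  interpret M: real_distribution M by (rule M)
  have lim: "(\<lambda>k. integral\<^sup>L (Q (r k)) (\<lambda>z. f (e z))) \<longlonglongrightarrow> integral\<^sup>L M f"
    if f: "\<And>x. isCont f x" "\<And>x. norm (f x) \<le> 1" for f :: "real \<Rightarrow> real"
  proof -
    have [measurable]: "f \<in> borel_measurable borel"
      using f(1) by (intro borel_measurable_continuous_onI) (auto simp: continuous_on_eq_continuous_at)
    have "(\<lambda>k. integral\<^sup>L ((R \<circ> id \<circ> r) k) f) \<longlonglongrightarrow> integral\<^sup>L M f"
      by (rule weak_conv_imp_integral_bdd_continuous_conv[OF _ M wc f]) (simp add: R)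
    then show ?thesis by (simp add: R_def integral_distr)
  qed
  define u where "u = (\<lambda>i :: 'i. detect_bit (to_nat i))"
  have u_cont: "isCont (u i) x" for i x by (simp add: u_def isCont_detect_bit)
  then have u_meas[measurable]: "u i \<in> borel_measurable borel" for i
    by (intro borel_measurable_continuous_onI) (auto simp: continuous_on_eq_continuous_at)
  have u01: "0 \<le> u i x" "u i x \<le> 1" for i x by (auto simp: u_def detect_bit_bounds)
  have ue: "u i (e z) = (if b i z then 1 else 0)" for i z
    by (simp add: u_def e_def detect_bit_encode_bits)
  define b' where "b' = (\<lambda>i x. u i x = 1)"
  have [measurable]: "Measurable.pred M (b' i)" for i
    unfolding b'_def by measurable
  (* u (1 - u) vanishes on all codes, hence in the limit. *)
  have bin: "AE x in M. u i x = 0 \<or> u i x = 1" for i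
  proof -
    have "(\<lambda>k. integral\<^sup>L (Q (r k)) (\<lambda>z. u i (e z) * (1 - u i (e z)))) \<longlonglongrightarrow> (\<integral>x. u i x * (1 - u i x) \<partial>M)"
      using u01 by (intro lim continuous_intros u_cont) (auto simp: abs_mult intro!: mult_le_one)
    moreover have "u i (e z) * (1 - u i (e z)) = 0" for z by (simp add: ue)
    ultimately have "(\<integral>x. u i x * (1 - u i x) \<partial>M) = 0" by (simp add: LIMSEQ_const_iff)
    moreover have "integrable M (\<lambda>x. u i x * (1 - u i x))"
      using u01 by (intro M.integrable_const_bound[of _ 1]) (auto simp: abs_mult intro!: mult_le_one)
    ultimately have "AE x in M. u i x * (1 - u i x) = 0"
      using u01 by (subst (asm) integral_nonneg_eq_0_iff_AE) auto
    then show ?thesis by eventually_elim auto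
  qed
  have main: "(\<lambda>k. measure (Q (r k)) {z \<in> space (Q (r k)). \<forall>i\<in>J. b i z = \<sigma> i})
        \<longlonglongrightarrow> measure M {\<omega> \<in> space M. \<forall>i\<in>J. b' i \<omega> = \<sigma> i}" if J: "finite J" for J \<sigma>
  proof -
    define F where "F = (\<lambda>x. \<Prod>i\<in>J. if \<sigma> i then u i x else 1 - u i x)"
    have F01: "0 \<le> F x" "F x \<le> 1" for x
      unfolding F_def using u01 by (auto intro!: prod_nonneg prod_le_1)
    have "isCont (\<lambda>x. if \<sigma> i then u i x else 1 - u i x) x" for i x
      by (cases "\<sigma> i") (auto intro!: continuous_intros u_cont)
    then have F_cont: "isCont F x" for x
      unfolding F_def by (intro continuous_intros)
    have "(\<lambda>k. integral\<^sup>L (Q (r k)) (\<lambda>z. F (e z))) \<longlonglongrightarrow> integral\<^sup>L M F"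
      by (rule lim[OF F_cont]) (use F01 in auto)
    moreover have "integral\<^sup>L (Q m) (\<lambda>z. F (e z)) = measure (Q m) {z \<in> space (Q m). \<forall>i\<in>J. b i z = \<sigma> i}" for m
    proof -
      have "F (e z) = indicator {z \<in> space (Q m). \<forall>i\<in>J. b i z = \<sigma> i} z" if "z \<in> space (Q m)" for z
        using J that by (auto simp: F_def ue indicator_def intro!: prod.neutral)
      then have "integral\<^sup>L (Q m) (\<lambda>z. F (e z)) = integral\<^sup>L (Q m) (indicator {z \<in> space (Q m). \<forall>i\<in>J. b i z = \<sigma> i})"
        by (intro Bochner_Integration.integral_cong) auto
      then show ?thesis by simp
    qed
    moreover have "integral\<^sup>L M F = measure M {\<omega> \<in> space M. \<forall>i\<in>J. b' i \<omega> = \<sigma> i}"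
    proof -
      have "AE x in M. \<forall>i\<in>J. u i x = 0 \<or> u i x = 1"
        using J bin by (simp add: AE_finite_all)
      then have "AE x in M. F x = indicator {\<omega> \<in> space M. \<forall>i\<in>J. b' i \<omega> = \<sigma> i} x"
      proof (eventually_elim)
        case (elim x)
        show ?case
        proof (cases "\<forall>i\<in>J. b' i x = \<sigma> i")
          case True
          then have "F x = 1" using elim by (auto simp: F_def b'_def intro!: prod.neutral)
          then show ?thesis using True by simp
        next
          case False
          then obtain i where "i \<in> J" "b' i x \<noteq> \<sigma> i" by blast
          then have "F x = 0" using J elim by (auto simp: F_def b'_def intro!: bexI[of _ i])
          then show ?thesis using False by simp
        qed
      qed
      then have "integral\<^sup>L M F = integral\<^sup>L M (indicator {\<omega> \<in> space M. \<forall>i\<in>J. b' i \<omega> = \<sigma> i})"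
        using J by (intro integral_cong_AE) (auto simp: F_def)
      then show ?thesis using J by simp
    qed
    ultimately show ?thesis by simp
  qed
  show thesis by (rule that[OF r M.prob_space_axioms _ main]) auto
qed

section \<open>Lipschitz test functions from finite potentials\<close>

lemma borel_measurable_lower_semicontinuous:
  fixes \<rho> :: "'e::second_countable_topology \<Rightarrow> 'e \<Rightarrow> ennreal"
  assumes "lower_semicontinuous (\<lambda>(x, y). \<rho> x y)"
  shows "(\<lambda>z. \<rho> (fst z) (snd z)) \<in> borel_measurable (borel \<Otimes>\<^sub>M borel)"
  unfolding borel_prod
proof (rule borel_measurableI_greater)
  fix c
  have "open {z. c < \<rho> (fst z) (snd z)}"
    using assms by (simp add: lower_semicontinuous_def case_prod_beta)
  then show "{z \<in> space borel. c < \<rho> (fst z) (snd z)} \<in> sets borel"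
    by simp
qed

lemma open_forall_compact:
  fixes W :: "('a::topological_space \<times> 'b::topological_space) set"
  assumes "open W" "compact K"
  shows "open {x. \<forall>y\<in>K. (x, y) \<in> W}"
proof (subst open_subopen, rule ballI)
  fix x assume x: "x \<in> {x. \<forall>y\<in>K. (x, y) \<in> W}"
  have "\<exists>A B. open A \<and> open B \<and> x \<in> A \<and> y \<in> B \<and> A \<times> B \<subseteq> W" if "y \<in> K" for y
  proof -
    have "(x, y) \<in> W" using x that by simp
    with assms(1) obtain A B where "open A" "open B" "(x, y) \<in> A \<times> B" "A \<times> B \<subseteq> W"
      by (rule open_prod_elim)
    then show ?thesis by (intro exI[of _ A] exI[of _ B]) auto
  qed
  then obtain A B where AB: "\<And>y. y \<in> K \<Longrightarrow> open (A y) \<and> open (B y) \<and> x \<in> A y \<and> y \<in> B y \<and> A y \<times> B y \<subseteq> W"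
    by metis
  obtain F where F: "F \<subseteq> K" "finite F" "K \<subseteq> (\<Union>y\<in>F. B y)"
    by (rule compactE_image[OF assms(2), of K B]) (use AB in auto)
  have "open (\<Inter>y\<in>F. A y)" "x \<in> (\<Inter>y\<in>F. A y)" using F AB by auto
  moreover have "(\<Inter>y\<in>F. A y) \<subseteq> {x. \<forall>y\<in>K. (x, y) \<in> W}" using F AB by blast
  ultimately show "\<exists>T. open T \<and> x \<in> T \<and> T \<subseteq> {x. \<forall>y\<in>K. (x, y) \<in> W}"
    by (intro exI[of _ "\<Inter>y\<in>F. A y"] conjI)
qed

text \<open>
  Infima over uncountable sets need not be Borel in the parameter; compactness of \<open>K\<close> makes the
  partial infimum lower semicontinuous.
\<close>

lemma borel_measurable_INF_compact:
  fixes \<rho> :: "'e::topological_space \<Rightarrow> 'e \<Rightarrow> ennreal"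
  assumes "lower_semicontinuous (\<lambda>(x, y). \<rho> x y)" "compact K"
  shows "(\<lambda>x. INF y\<in>K. \<rho> x y) \<in> borel_measurable borel"
proof (rule borel_measurableI_greater)
  fix c
  have "open {x. \<forall>y\<in>K. (x, y) \<in> {z. d < \<rho> (fst z) (snd z)}}" for d
    using assms by (intro open_forall_compact) (simp_all add: lower_semicontinuous_def case_prod_beta)
  then have "open (\<Union>d\<in>{c<..}. {x. \<forall>y\<in>K. d < \<rho> x y})" by auto
  also have "(\<Union>d\<in>{c<..}. {x. \<forall>y\<in>K. d < \<rho> x y}) = {x. c < (INF y\<in>K. \<rho> x y)}"
  proof safe
    fix x d assume "c < d" "\<forall>y\<in>K. d < \<rho> x y"
    then have "d \<le> (INF y\<in>K. \<rho> x y)" by (intro INF_greatest) auto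
    with \<open>c < d\<close> show "c < (INF y\<in>K. \<rho> x y)" by simp
  next
    fix x assume "c < (INF y\<in>K. \<rho> x y)"
    then obtain d where d: "c < d" "d < (INF y\<in>K. \<rho> x y)" using dense by blast
    then show "x \<in> (\<Union>d\<in>{c<..}. {x. \<forall>y\<in>K. d < \<rho> x y})"
      by (auto intro!: bexI[of _ d] dest: less_INF_D)
  qed
  finally show "{x \<in> space borel. c < (INF y\<in>K. \<rho> x y)} \<in> sets borel" by simp
qed

lemma truncated_INF_lipschitz:
  fixes \<rho> :: "'e \<Rightarrow> 'e \<Rightarrow> ennreal"
  assumes "ext_semimetric \<rho>"
  shows "ennreal (enn2real (min (ennreal m) (INF z\<in>K. \<rho> x z))
    - enn2real (min (ennreal m) (INF z\<in>K. \<rho> y z))) \<le> \<rho> x y"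
proof (cases "\<rho> x y = \<top>")
  case False
  let ?I = "\<lambda>x. INF z\<in>K. \<rho> x z"
  have "?I x - \<rho> x y \<le> ?I y"
  proof (rule INF_greatest)
    fix z assume "z \<in> K"
    then have "?I x \<le> \<rho> x z" by (rule INF_lower)
    also have "\<dots> \<le> \<rho> x y + \<rho> y z" using assms by (auto simp: ext_semimetric_def)
    finally show "?I x - \<rho> x y \<le> \<rho> y z" using False by (simp add: ennreal_minus_le_iff)
  qed
  then have "?I x \<le> \<rho> x y + ?I y" using False by (simp add: ennreal_minus_le_iff)
  then have "min (ennreal m) (?I x) \<le> \<rho> x y + min (ennreal m) (?I y)"
    by (cases "ennreal m \<le> ?I y")
      (simp_all add: min_absorb1 min_absorb2 min.coboundedI1 min.coboundedI2 add_increasing)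
  moreover obtain a where a: "min (ennreal m) (?I x) = ennreal a" "0 \<le> a"
    by (cases "min (ennreal m) (?I x)") (auto simp: min_def split: if_splits)
  moreover obtain b where b: "min (ennreal m) (?I y) = ennreal b" "0 \<le> b"
    by (cases "min (ennreal m) (?I y)") (auto simp: min_def split: if_splits)
  moreover obtain r where r: "\<rho> x y = ennreal r" "0 \<le> r" using False by (cases "\<rho> x y") auto
  ultimately show ?thesis by (simp flip: ennreal_plus add: ennreal_leI)
qed simp

text \<open>
  The natural \<open>1\<close>-Lipschitz function between \<open>\<phi>\<close> and \<open>-\<psi>\<close> is \<open>f x = inf\<^sub>y (\<rho> x y - \<psi> y)\<close>, but it may
  fail to be Borel measurable. By inner regularity of \<open>\<nu>\<close>, each level set \<open>{\<psi> = v}\<close> contains a compact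
  set \<open>K v\<close> that carries almost all of its mass; taking the infimum over these compact sets only
  makes \<open>f\<close> measurable, keeps \<open>\<phi> \<le> f\<close>, and loses \<open>f \<le> -\<psi>\<close> only on a set of small \<open>\<nu>\<close>-measure.
  Truncating \<open>\<rho>\<close> at \<open>2 C\<close>, an upper bound for \<open>\<phi> x + \<psi> y\<close>, makes \<open>f\<close> bounded and covers empty \<open>K v\<close>.
\<close>

lemma simple_dual_bound:
  fixes \<rho> :: "'e::polish_space \<Rightarrow> 'e \<Rightarrow> ennreal" and \<phi> \<psi> :: "'e \<Rightarrow> real"
  assumes lsc: "lower_semicontinuous (\<lambda>(x, y). \<rho> x y)" and semi: "ext_semimetric \<rho>"
    and \<mu>: "prob_space \<mu>" "sets \<mu> = sets borel" and \<nu>: "prob_space \<nu>" "sets \<nu> = sets borel"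
    and lip: "\<And>f :: 'e \<Rightarrow> real. f \<in> borel_measurable borel \<Longrightarrow> bounded (range f) \<Longrightarrow>
      (\<And>x y. ennreal (f x - f y) \<le> \<rho> x y) \<Longrightarrow> integral\<^sup>L \<mu> f - integral\<^sup>L \<nu> f \<le> L"
    and meas: "\<phi> \<in> borel_measurable borel" "\<psi> \<in> borel_measurable borel"
    and fin: "finite (range \<phi>)" "finite (range \<psi>)"
    and le: "\<And>x y. ennreal (\<phi> x + \<psi> y) \<le> \<rho> x y"
  shows "integral\<^sup>L \<mu> \<phi> + integral\<^sup>L \<nu> \<psi> \<le> L"
proof (rule field_le_epsilon)
  fix e :: real assume e: "0 < e"
  interpret \<mu>: prob_space \<mu> by fact
  interpret \<nu>: prob_space \<nu> by fact
  have sp: "space \<mu> = UNIV" "space \<nu> = UNIV"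
    using \<mu>(2) \<nu>(2) by (auto dest: sets_eq_imp_space_eq)
  have bm: "borel_measurable \<mu> = borel_measurable (borel :: 'e measure)"
    "borel_measurable \<nu> = borel_measurable (borel :: 'e measure)"
    using \<mu>(2) \<nu>(2) by (auto intro!: measurable_cong_sets)
  obtain C where C: "\<And>x. \<bar>\<phi> x\<bar> \<le> C" "\<And>x. \<bar>\<psi> x\<bar> \<le> C"
  proof -
    obtain C1 where "\<forall>r\<in>range \<phi>. norm r \<le> C1" using finite_imp_bounded[OF fin(1)] by (auto simp: bounded_iff)
    moreover obtain C2 where "\<forall>r\<in>range \<psi>. norm r \<le> C2" using finite_imp_bounded[OF fin(2)] by (auto simp: bounded_iff)
    ultimately show thesis by (intro that[of "max C1 C2"]) (auto simp: le_max_iff_disj)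
  qed
  have C0: "0 \<le> C" using C(1)[of undefined] by linarith
  define V where "V = range \<psi>"
  have V: "finite V" "V \<noteq> {}" by (auto simp: V_def fin)
  define \<delta> where "\<delta> = e / (2 * C + 1) / card V"
  have \<delta>: "\<delta> > 0" using e C0 V by (simp add: \<delta>_def card_gt_0_iff)
  have lev: "\<psi> -` {v} \<in> sets borel" for v
    using measurable_sets[OF meas(2), of "{v}"] by simp
  have "\<exists>K. K \<subseteq> \<psi> -` {v} \<and> compact K \<and> measure \<nu> (\<psi> -` {v} - K) \<le> \<delta>" for v
  proof -
    let ?F = "{K. K \<subseteq> \<psi> -` {v} \<and> compact K}"
    have "emeasure \<nu> (\<psi> -` {v}) = (SUP K\<in>?F. emeasure \<nu> K)"
      using \<nu>(2) lev by (intro inner_regular) auto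
    then have "\<exists>K\<in>?F. emeasure \<nu> (\<psi> -` {v}) < emeasure \<nu> K + ennreal \<delta>"
    proof (rule SUP_approx_ennreal[OF \<delta>, rotated])
      have "{} \<in> ?F" by simp
      then show "?F \<noteq> {}" by blast
    qed simp
    then obtain K where K: "K \<subseteq> \<psi> -` {v}" "compact K"
      and "emeasure \<nu> (\<psi> -` {v}) < emeasure \<nu> K + ennreal \<delta>" by blast
    then have "measure \<nu> (\<psi> -` {v}) < measure \<nu> K + \<delta>"
      using \<delta> by (simp add: \<nu>.emeasure_eq_measure ennreal_less_iff flip: ennreal_plus)
    moreover have "measure \<nu> (\<psi> -` {v} - K) = measure \<nu> (\<psi> -` {v}) - measure \<nu> K"
      using K lev by (intro \<nu>.finite_measure_Diff) (auto simp: \<nu>(2) borel_compact)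
    ultimately show ?thesis using K by (intro exI[of _ K]) auto
  qed
  then obtain K where K: "\<And>v. K v \<subseteq> \<psi> -` {v}" "\<And>v. compact (K v)"
    "\<And>v. measure \<nu> (\<psi> -` {v} - K v) \<le> \<delta>" by metis
  define g where "g = (\<lambda>v x. enn2real (min (ennreal (2 * C)) (INF y\<in>K v. \<rho> x y)))"
  have g_meas: "g v \<in> borel_measurable borel" for v
    unfolding g_def using borel_measurable_INF_compact[OF lsc K(2)[of v]] by measurable
  have g_le: "g v x \<le> 2 * C" for v x
    unfolding g_def using C0 by (intro enn2real_leI) auto
  define f where "f = (\<lambda>x. Min ((\<lambda>v. g v x - v) ` V))"
  have f_meas: "f \<in> borel_measurable borel"
    unfolding f_def using V g_meas by (intro borel_measurable_Min) auto
  have f_le: "f x \<le> g v x - v" if "v \<in> V" for v x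
    unfolding f_def using V that by (intro Min_le) auto
  (* g v is the distance to K v truncated at 2 * C, so the minimum also makes sense
     when some K v is empty. *)
  have \<phi>_le: "\<phi> x \<le> f x" for x
    unfolding f_def
  proof (rule Min.boundedI)
    fix a assume "a \<in> (\<lambda>v. g v x - v) ` V"
    then obtain v where v: "v \<in> V" "a = g v x - v" by blast
    have "ennreal (\<phi> x + v) \<le> (INF y\<in>K v. \<rho> x y)"
    proof (rule INF_greatest)
      fix y assume "y \<in> K v"
      then have "\<psi> y = v" using K(1) by auto
      then show "ennreal (\<phi> x + v) \<le> \<rho> x y" using le by blast
    qed
    moreover have "\<phi> x + v \<le> 2 * C"
    proof -
      obtain y where "v = \<psi> y" using v(1) by (auto simp: V_def)
      then show ?thesis using C(1)[of x] C(2)[of y] by simp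
    qed
    ultimately have "ennreal (\<phi> x + v) \<le> min (ennreal (2 * C)) (INF y\<in>K v. \<rho> x y)"
      by (simp add: ennreal_leI)
    then have "enn2real (ennreal (\<phi> x + v)) \<le> g v x"
      unfolding g_def by (intro enn2real_mono) (auto simp: min_less_iff_disj)
    moreover have "0 \<le> g v x" by (simp add: g_def)
    ultimately have "\<phi> x + v \<le> g v x" by (cases "0 \<le> \<phi> x + v") auto
    then show "\<phi> x \<le> a" using v by simp
  qed (use V in auto)
  have f_up: "f x + \<psi> x \<le> 2 * C" for x
    using f_le[of "\<psi> x" x] g_le[of "\<psi> x" x] by (simp add: V_def)
  define N where "N = (\<Union>v\<in>V. \<psi> -` {v} - K v)"
  have N_meas: "N \<in> sets \<nu>"
    unfolding N_def \<nu>(2) using V lev K(2) by (intro sets.finite_UN) (auto simp: borel_compact)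
  have "measure \<nu> N \<le> (\<Sum>v\<in>V. measure \<nu> (\<psi> -` {v} - K v))"
    unfolding N_def using V lev K(2)
    by (intro \<nu>.finite_measure_subadditive_finite) (auto simp: \<nu>(2) borel_compact)
  also have "\<dots> \<le> (\<Sum>v\<in>V. \<delta>)" using K(3) by (intro sum_mono) auto
  also have "\<dots> = e / (2 * C + 1)" using V by (simp add: \<delta>_def)
  finally have N_le: "measure \<nu> N \<le> e / (2 * C + 1)" .
  have f_on_K: "f x + \<psi> x \<le> 0" if "x \<notin> N" for x
  proof -
    have "x \<in> K (\<psi> x)" using that by (auto simp: N_def V_def)
    then have "(INF y\<in>K (\<psi> x). \<rho> x y) \<le> \<rho> x x" by (rule INF_lower)
    then have "g (\<psi> x) x = 0" using semi by (simp add: g_def ext_semimetric_def)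
    then show ?thesis using f_le[of "\<psi> x" x] by (simp add: V_def)
  qed
  have f_bdd: "\<bar>f x\<bar> \<le> 3 * C" for x
    using f_up[of x] \<phi>_le[of x] C[of x] by (auto simp: abs_le_iff)
  have "integral\<^sup>L \<mu> f - integral\<^sup>L \<nu> f \<le> L"
  proof (rule lip[OF f_meas])
    show "bounded (range f)" using f_bdd by (auto simp: bounded_iff)
    fix x y
    have "f y \<in> (\<lambda>v. g v y - v) ` V" unfolding f_def using V by (intro Min_in) auto
    then obtain v where v: "v \<in> V" "f y = g v y - v" by blast
    have "f x - f y \<le> g v x - g v y" using f_le[OF v(1), of x] v by simp
    then have "ennreal (f x - f y) \<le> ennreal (g v x - g v y)" by (rule ennreal_leI)
    also have "\<dots> \<le> \<rho> x y" unfolding g_def by (rule truncated_INF_lipschitz[OF semi])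
    finally show "ennreal (f x - f y) \<le> \<rho> x y" .
  qed
  moreover have "integral\<^sup>L \<mu> \<phi> \<le> integral\<^sup>L \<mu> f"
    using \<phi>_le f_bdd C meas f_meas
    by (intro integral_mono \<mu>.integrable_const_bound[of _ "3 * C"] \<mu>.integrable_const_bound[of _ C])
      (auto simp: bm)
  moreover have "integral\<^sup>L \<nu> f + integral\<^sup>L \<nu> \<psi> \<le> e"
  proof -
    have int: "integrable \<nu> f" "integrable \<nu> \<psi>"
      using f_bdd f_meas C(2) meas(2)
      by (simp_all add: bm \<nu>.integrable_const_bound[of _ "3 * C"] \<nu>.integrable_const_bound[of _ C])
    have "integral\<^sup>L \<nu> f + integral\<^sup>L \<nu> \<psi> = (\<integral>x. f x + \<psi> x \<partial>\<nu>)"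
      using int by simp
    also have "\<dots> \<le> (\<integral>x. 2 * C * indicator N x \<partial>\<nu>)"
    proof (rule integral_mono)
      show "f x + \<psi> x \<le> 2 * C * indicator N x" for x
        using f_up f_on_K by (cases "x \<in> N") auto
      have "integrable \<nu> (indicat_real N)"
        using N_meas by (intro integrable_real_indicator) (auto simp: less_top[symmetric])
      then show "integrable \<nu> (\<lambda>x. 2 * C * indicator N x)" by simp
    qed (use int in auto)
    also have "\<dots> = 2 * C * measure \<nu> N" using N_meas by (simp add: sp)
    also have "\<dots> \<le> 2 * C * (e / (2 * C + 1))" using N_le C0 by (intro mult_left_mono) auto
    also have "\<dots> \<le> e" using e C0 by (simp add: field_simps)
    finally show ?thesis .
  qed
  ultimately show "integral\<^sup>L \<mu> \<phi> + integral\<^sup>L \<nu> \<psi> \<le> L + e" by linarith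
qed

section \<open>Coding points of a Polish space by bits\<close>

definition code :: "(nat \<Rightarrow> 'e set) \<Rightarrow> nat \<Rightarrow> 'e \<Rightarrow> bool list" where
  "code U n x = map (\<lambda>i. x \<in> U i) [0..<n]"

lemma length_code [simp]: "length (code U n x) = n"
  by (simp add: code_def)

lemma take_code: "n \<le> m \<Longrightarrow> take n (code U m x) = code U n x"
  by (simp add: code_def take_map take_upt)

lemma nth_code: "i < n \<Longrightarrow> code U n x ! i \<longleftrightarrow> x \<in> U i"
  by (simp add: code_def)

lemma map_upt_eq_iff: "map f [0..<n] = \<sigma> \<longleftrightarrow> length \<sigma> = n \<and> (\<forall>i<n. f i = \<sigma> ! i)"
  by (subst list_eq_iff_nth_eq) auto

lemma measurable_map_upt:
  assumes "\<And>i. Measurable.pred M (b i)"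
  shows "(\<lambda>\<omega>. map (\<lambda>i. b i \<omega>) [0..<n]) \<in> M \<rightarrow>\<^sub>M count_space (UNIV :: bool list set)"
proof (subst measurable_count_space_eq2_countable, intro conjI ballI)
  note assms[measurable]
  fix \<sigma> :: "bool list"
  have "(\<lambda>\<omega>. map (\<lambda>i. b i \<omega>) [0..<n]) -` {\<sigma>} \<inter> space M
      = {\<omega> \<in> space M. length \<sigma> = n \<and> (\<forall>i\<in>{..<n}. b i \<omega> = \<sigma> ! i)}"
    by (simp add: set_eq_iff map_upt_eq_iff Bex_def Ball_def) blast
  also have "\<dots> \<in> sets M" by measurable
  finally show "(\<lambda>\<omega>. map (\<lambda>i. b i \<omega>) [0..<n]) -` {\<sigma>} \<inter> space M \<in> sets M" .
qed auto

lemma measurable_Pair_count_space: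
  fixes f :: "'w \<Rightarrow> 's::countable" and g :: "'w \<Rightarrow> 't::countable"
  assumes "f \<in> M \<rightarrow>\<^sub>M count_space UNIV" "g \<in> M \<rightarrow>\<^sub>M count_space UNIV"
  shows "(\<lambda>\<omega>. (f \<omega>, g \<omega>)) \<in> M \<rightarrow>\<^sub>M count_space UNIV"
proof -
  have "count_space UNIV \<Otimes>\<^sub>M count_space UNIV = count_space (UNIV :: ('s \<times> 't) set)"
    by (simp add: pair_measure_countable)
  then show ?thesis using measurable_Pair[OF assms] by simp
qed

lemma measurable_code:
  assumes "\<And>i. U i \<in> sets M"
  shows "code U n \<in> M \<rightarrow>\<^sub>M count_space UNIV"
  unfolding code_def[abs_def] using assms by (intro measurable_map_upt) auto

text \<open>
  The truncation at \<open>n\<close> keeps the cost finite, also for empty cells (over which the infimum is \<open>\<infinity>\<close>)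
  and for cells at infinite distance.
\<close>

definition cell_cost ::
  "(nat \<Rightarrow> 'e set) \<Rightarrow> ('e \<Rightarrow> 'e \<Rightarrow> ennreal) \<Rightarrow> nat \<Rightarrow> bool list \<Rightarrow> bool list \<Rightarrow> ennreal" where
  "cell_cost U \<rho> n \<sigma> \<tau> =
     min (of_nat n) (INF z\<in>{z. code U n (fst z) = \<sigma> \<and> code U n (snd z) = \<tau>}. \<rho> (fst z) (snd z))"

lemma cell_cost_le_of_nat: "cell_cost U \<rho> n \<sigma> \<tau> \<le> of_nat n"
  by (simp add: cell_cost_def)

lemma cell_cost_finite: "cell_cost U \<rho> n \<sigma> \<tau> < \<top>"
  by (rule le_less_trans[OF cell_cost_le_of_nat]) (rule of_nat_less_top)

lemma cell_cost_code_le: "cell_cost U \<rho> n (code U n x) (code U n y) \<le> \<rho> x y"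
  unfolding cell_cost_def
  by (rule min.coboundedI2, rule INF_lower2[of "(x, y)"]) auto

lemma cell_cost_mono:
  assumes "n \<le> m"
  shows "cell_cost U \<rho> n (take n \<sigma>) (take n \<tau>) \<le> cell_cost U \<rho> m \<sigma> \<tau>"
  unfolding cell_cost_def using assms
  by (intro min.mono INF_superset_mono) (auto simp: take_code[symmetric])

text \<open>
  This is where lower semicontinuity enters: \<open>{\<rho> > r}\<close> is open, hence contains a product of two
  basic open sets around \<open>(x, y)\<close>, and the cells of \<open>x\<close> and \<open>y\<close> lie in these as soon as \<open>n\<close> exceeds
  the indices of both.
\<close>

lemma SUP_cell_cost:
  fixes \<rho> :: "'e::second_countable_topology \<Rightarrow> 'e \<Rightarrow> ennreal"
  assumes base: "topological_basis (range U)"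
    and lsc: "lower_semicontinuous (\<lambda>(x, y). \<rho> x y)"
  shows "(SUP n. cell_cost U \<rho> n (code U n x) (code U n y)) = \<rho> x y"
proof (rule antisym)
  show "(SUP n. cell_cost U \<rho> n (code U n x) (code U n y)) \<le> \<rho> x y"
    by (intro SUP_least cell_cost_code_le)
  show "\<rho> x y \<le> (SUP n. cell_cost U \<rho> n (code U n x) (code U n y))"
  proof (rule dense_le)
    fix r assume r: "r < \<rho> x y"
    let ?W = "{z. r < \<rho> (fst z) (snd z)}"
    have "open ?W" using lsc by (simp add: lower_semicontinuous_def case_prod_beta)
    moreover have "(x, y) \<in> ?W" using r by simp
    ultimately obtain A B where "open A" "open B" "(x, y) \<in> A \<times> B" "A \<times> B \<subseteq> ?W"
      by (rule open_prod_elim)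
    then have AB: "open A" "open B" "x \<in> A" "y \<in> B" "A \<times> B \<subseteq> ?W" by auto
    obtain i where i: "x \<in> U i" "U i \<subseteq> A"
      using topological_basisE[OF base AB(1,3)] by (metis imageE)
    obtain j where j: "y \<in> U j" "U j \<subseteq> B"
      using topological_basisE[OF base AB(2,4)] by (metis imageE)
    have "r < \<top>" using r by (rule less_le_trans) simp
    then obtain N where N: "r \<le> of_nat N"
      using ennreal_Ex_less_of_nat[of r] by (auto intro: less_imp_le)
    define n where "n = max N (Suc (max i j))"
    have "r \<le> cell_cost U \<rho> n (code U n x) (code U n y)"
      unfolding cell_cost_def
    proof (intro min.boundedI INF_greatest)
      show "r \<le> of_nat n"
        using N by (rule order_trans) (simp add: n_def)
      fix z assume z: "z \<in> {z. code U n (fst z) = code U n x \<and> code U n (snd z) = code U n y}"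
      have "i < n" "j < n" by (auto simp: n_def)
      then have "fst z \<in> U i" "snd z \<in> U j"
        using z i(1) j(1) nth_code[of _ n U] by (metis (mono_tags, lifting) mem_Collect_eq)+
      then have "z \<in> A \<times> B" using i(2) j(2) by (simp add: mem_Times_iff subset_iff)
      then show "r \<le> \<rho> (fst z) (snd z)" using AB(5) by auto
    qed
    also have "\<dots> \<le> (SUP n. cell_cost U \<rho> n (code U n x) (code U n y))" by (rule SUP_upper) simp
    finally show "r \<le> (SUP n. cell_cost U \<rho> n (code U n x) (code U n y))" .
  qed
qed

text \<open>
  A point is the limit of arbitrarily chosen points in the cells that contain it. Defining the
  decoder as this limit whenever the chosen points form a Cauchy sequence makes it measurable on all
  bit sequences, including those that are the code of no point.
\<close>

lemma measurable_decoding: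
  fixes U :: "nat \<Rightarrow> 'e::polish_space set"
  assumes base: "topological_basis (range U)"
  obtains D :: "(nat \<Rightarrow> bool) \<Rightarrow> 'e"
  where "D \<in> PiM UNIV (\<lambda>_. count_space UNIV) \<rightarrow>\<^sub>M borel" and "\<And>x. D (\<lambda>i. x \<in> U i) = x"
proof -
  define a where "a = (\<lambda>\<sigma>. SOME x. code U (length \<sigma>) x = \<sigma>)"
  define An where "An = (\<lambda>n (s :: nat \<Rightarrow> bool). a (map s [0..<n]))"
  have An[measurable]: "An n \<in> PiM UNIV (\<lambda>_. count_space UNIV) \<rightarrow>\<^sub>M borel" for n
  proof -
    have "(\<lambda>s. map (\<lambda>i. s i) [0..<n]) \<in> PiM UNIV (\<lambda>_. count_space UNIV) \<rightarrow>\<^sub>M count_space (UNIV :: bool list set)"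
      by (rule measurable_map_upt) measurable
    then show ?thesis unfolding An_def by (rule measurable_compose) simp
  qed
  define Bn where "Bn = (\<lambda>n s. if Cauchy (\<lambda>n. An n s) then An n s else a [])"
  have Bn[measurable]: "Bn n \<in> PiM UNIV (\<lambda>_. count_space UNIV) \<rightarrow>\<^sub>M borel" for n
    unfolding Bn_def by (intro measurable_If measurable_const An sets_Collect_Cauchy) simp_all
  define D where "D = (\<lambda>s. lim (\<lambda>n. Bn n s))"
  have "(\<lambda>n. Bn n s) \<longlonglongrightarrow> D s" for s
    unfolding D_def convergent_LIMSEQ_iff[symmetric]
    by (cases "Cauchy (\<lambda>n. An n s)") (simp_all add: Bn_def convergent_const Cauchy_convergent)
  then have "D \<in> PiM UNIV (\<lambda>_. count_space UNIV) \<rightarrow>\<^sub>M borel"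
    by (rule borel_measurable_LIMSEQ_metric[where f = Bn, rotated]) (rule Bn)
  moreover have "D (\<lambda>i. x \<in> U i) = x" for x
  proof -
    let ?s = "\<lambda>i. x \<in> U i"
    have cell: "code U n (An n ?s) = code U n x" for n
    proof -
      have "code U (length (code U n x)) (a (code U n x)) = code U n x"
        unfolding a_def by (rule someI[of _ x]) simp
      then show ?thesis by (simp add: An_def code_def)
    qed
    have lim: "(\<lambda>n. An n ?s) \<longlonglongrightarrow> x"
    proof (rule topological_tendstoI)
      fix S assume S: "open S" "x \<in> S"
      obtain i where i: "x \<in> U i" "U i \<subseteq> S"
        using topological_basisE[OF base S] by (metis imageE)
      have "An n ?s \<in> S" if "i < n" for n
        using cell[of n] nth_code[OF that, of U] i by (metis subsetD)
      then show "eventually (\<lambda>n. An n ?s \<in> S) sequentially"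
        by (auto simp: eventually_sequentially intro!: exI[of _ "Suc i"])
    qed
    then have "Bn n ?s = An n ?s" for n by (simp add: Bn_def LIMSEQ_imp_Cauchy)
    then show ?thesis using lim by (simp add: D_def limI)
  qed
  ultimately show thesis by (rule that)
qed

lemma sequence_law_eqI:
  fixes P Q :: "(nat \<Rightarrow> bool) measure"
  assumes sets: "sets P = sets (PiM UNIV (\<lambda>_. count_space UNIV))"
      "sets Q = sets (PiM UNIV (\<lambda>_. count_space UNIV))"
    and P: "finite_measure P"
    and eq: "\<And>n. distr P (count_space UNIV) (\<lambda>s. map s [0..<n]) = distr Q (count_space UNIV) (\<lambda>s. map s [0..<n])"
  shows "P = Q"
proof (rule measure_eqI_PiM_infinite[OF sets _ P])
  fix J :: "nat set" and A :: "nat \<Rightarrow> bool set"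
  assume J: "finite J"
  then obtain n where n: "J \<subseteq> {..<n}" using finite_nat_iff_bounded by blast
  then have n': "\<And>j. j \<in> J \<Longrightarrow> j < n" by auto
  define S where "S = {\<sigma>. \<forall>j\<in>J. \<sigma> ! j \<in> A j}"
  have em: "emeasure R (prod_emb UNIV (\<lambda>_. count_space UNIV) J (Pi\<^sub>E J A))
      = emeasure (distr R (count_space UNIV) (\<lambda>s. map s [0..<n])) S"
    if R: "sets R = sets (PiM UNIV (\<lambda>_. count_space (UNIV :: bool set)))" for R
  proof -
    have sp: "space R = UNIV" using sets_eq_imp_space_eq[OF R] by (simp add: space_PiM)
    have "(\<lambda>s. map (\<lambda>i. s i) [0..<n]) \<in> PiM UNIV (\<lambda>_. count_space UNIV) \<rightarrow>\<^sub>M count_space (UNIV :: bool list set)"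
      by (rule measurable_map_upt) measurable
    then have "(\<lambda>s. map s [0..<n]) \<in> R \<rightarrow>\<^sub>M count_space UNIV"
      using measurable_cong_sets[OF R refl] by auto
    moreover have "prod_emb UNIV (\<lambda>_. count_space UNIV) J (Pi\<^sub>E J A) = (\<lambda>s. map s [0..<n]) -` S"
      using n' by (auto simp: prod_emb_def S_def PiE_iff)
    ultimately show ?thesis by (simp add: emeasure_distr sp)
  qed
  show "emeasure P (prod_emb UNIV (\<lambda>_. count_space UNIV) J (Pi\<^sub>E J A)) =
      emeasure Q (prod_emb UNIV (\<lambda>_. count_space UNIV) J (Pi\<^sub>E J A))"
    using em[OF sets(1)] em[OF sets(2)] eq by simp
qed

text \<open>
  Random bits whose finite-dimensional laws are those of the code of a \<open>\<mu>\<close>-distributed point are,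
  almost surely, the code of the point that they decode to: the bit sequences have the same law, and
  being a code is a measurable property of the sequence once it is expressed through the decoder.
\<close>

lemma decode_law:
  fixes U :: "nat \<Rightarrow> 'e::polish_space set"
  assumes U: "\<And>i. U i \<in> sets borel"
    and D: "D \<in> PiM UNIV (\<lambda>_. count_space UNIV) \<rightarrow>\<^sub>M borel" "\<And>x. D (\<lambda>i. x \<in> U i) = x"
    and \<mu>: "prob_space \<mu>" "sets \<mu> = sets borel" and M: "prob_space M"
    and b: "\<And>i. Measurable.pred M (b i)"
    and eq: "\<And>n. distr M (count_space UNIV) (\<lambda>\<omega>. map (\<lambda>i. b i \<omega>) [0..<n])
      = distr \<mu> (count_space UNIV) (code U n)"
  shows "distr M borel (\<lambda>\<omega>. D (\<lambda>i. b i \<omega>)) = \<mu>"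
    and "AE \<omega> in M. \<forall>i. b i \<omega> \<longleftrightarrow> D (\<lambda>i. b i \<omega>) \<in> U i"
proof -
  let ?S = "PiM UNIV (\<lambda>_::nat. count_space (UNIV :: bool set))"
  interpret M: prob_space M by fact
  have U'[measurable]: "U i \<in> sets \<mu>" for i using U \<mu>(2) by simp
  have bits: "(\<lambda>\<omega> i. b i \<omega>) \<in> M \<rightarrow>\<^sub>M ?S" "(\<lambda>x i. x \<in> U i) \<in> \<mu> \<rightarrow>\<^sub>M ?S"
    by (auto intro!: measurable_PiM_single' b)
  have upt: "(\<lambda>s. map (\<lambda>i. s i) [0..<n]) \<in> ?S \<rightarrow>\<^sub>M count_space UNIV" for n
    by (rule measurable_map_upt) measurable
  have law: "distr M ?S (\<lambda>\<omega> i. b i \<omega>) = distr \<mu> ?S (\<lambda>x i. x \<in> U i)"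
  proof (rule sequence_law_eqI)
    show "finite_measure (distr M ?S (\<lambda>\<omega> i. b i \<omega>))"
      by (intro prob_space.finite_measure M.prob_space_distr bits)
    fix n
    show "distr (distr M ?S (\<lambda>\<omega> i. b i \<omega>)) (count_space UNIV) (\<lambda>s. map s [0..<n]) =
        distr (distr \<mu> ?S (\<lambda>x i. x \<in> U i)) (count_space UNIV) (\<lambda>s. map s [0..<n])"
      using eq[of n] upt[of n] bits by (simp add: distr_distr comp_def code_def[abs_def])
  qed auto
  have "distr M borel (\<lambda>\<omega>. D (\<lambda>i. b i \<omega>)) = distr (distr M ?S (\<lambda>\<omega> i. b i \<omega>)) borel D"
    using D(1) bits by (simp add: distr_distr comp_def)
  also have "\<dots> = distr \<mu> borel (\<lambda>x. x)"
    unfolding law using D bits by (simp add: distr_distr comp_def)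
  also have "\<dots> = \<mu>" using \<mu>(2) by (intro distr_id2) simp
  finally show "distr M borel (\<lambda>\<omega>. D (\<lambda>i. b i \<omega>)) = \<mu>" .
  have pred: "{s \<in> space ?S. \<forall>i. s i \<longleftrightarrow> D s \<in> U i} \<in> sets ?S"
    using D(1) U by measurable
  have "AE s in distr \<mu> ?S (\<lambda>x i. x \<in> U i). \<forall>i. s i \<longleftrightarrow> D s \<in> U i"
    using D(2) by (subst AE_distr_iff[OF bits(2) pred]) auto
  then show "AE \<omega> in M. \<forall>i. b i \<omega> \<longleftrightarrow> D (\<lambda>i. b i \<omega>) \<in> U i"
    unfolding law[symmetric] by (subst (asm) AE_distr_iff[OF bits(1) pred])
qed

lemma integral_finite_valued:
  fixes c :: "'s::countable \<Rightarrow> real"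
  assumes M: "prob_space M" and F: "F \<in> M \<rightarrow>\<^sub>M count_space UNIV" and I: "finite I" "AE \<omega> in M. F \<omega> \<in> I"
  shows "(\<integral>\<omega>. c (F \<omega>) \<partial>M) = (\<Sum>s\<in>I. c s * measure M {\<omega> \<in> space M. F \<omega> = s})"
proof -
  interpret prob_space M by fact
  note F[measurable]
  have "(\<integral>\<omega>. c (F \<omega>) \<partial>M) = (\<integral>\<omega>. (\<Sum>s\<in>I. c s * indicator {\<omega> \<in> space M. F \<omega> = s} \<omega>) \<partial>M)"
  proof (rule integral_cong_AE)
    show "AE \<omega> in M. c (F \<omega>) = (\<Sum>s\<in>I. c s * indicator {\<omega> \<in> space M. F \<omega> = s} \<omega>)"
      using I(2) AE_space
    proof eventually_elim
      case (elim \<omega>)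
      have "(\<Sum>s\<in>I. c s * indicator {\<omega> \<in> space M. F \<omega> = s} \<omega>) = (\<Sum>s\<in>I. if s = F \<omega> then c s else 0)"
        using elim by (intro sum.cong) auto
      then show ?case using elim I(1) by simp
    qed
  qed measurable
  also have "\<dots> = (\<Sum>s\<in>I. \<integral>\<omega>. c s * indicator {\<omega> \<in> space M. F \<omega> = s} \<omega> \<partial>M)"
    by (intro Bochner_Integration.integral_sum) (auto simp: emeasure_eq_measure)
  finally show ?thesis by simp
qed

lemma code_law_pmf:
  assumes \<mu>: "prob_space \<mu>" and U: "\<And>i. U i \<in> sets \<mu>"
  shows "\<exists>A. measure_pmf A = distr \<mu> (count_space UNIV) (code U n)"
proof -
  interpret prob_space \<mu> by fact
  interpret d: prob_space "distr \<mu> (count_space UNIV) (code U n)"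
    by (intro prob_space_distr measurable_code U)
  have "AE x in distr \<mu> (count_space UNIV) (code U n). measure (distr \<mu> (count_space UNIV) (code U n)) {x} \<noteq> 0"
    by (subst d.AE_support_countable) (auto intro!: exI[of _ UNIV])
  then show ?thesis
    using d.prob_space_axioms by (intro exI[of _ "Abs_pmf (distr \<mu> (count_space UNIV) (code U n))"])
      (subst Abs_pmf_inverse, auto)
qed

section \<open>Kantorovich-Rubinstein duality\<close>

text \<open>
  The hard half of the Kantorovich-Rubinstein theorem: if \<open>L\<close> is the supremum over the test functions,
  the coupling is optimal. It arises from plans of cost at most \<open>L\<close> between the cells of level \<open>n\<close>, whose joint
  codes converge in law along a subsequence, by decoding the limit.
\<close>

theorem kantorovich_rubinstein_coupling:
  fixes \<rho> :: "'e::polish_space \<Rightarrow> 'e \<Rightarrow> ennreal"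
  assumes lsc: "lower_semicontinuous (\<lambda>(x, y). \<rho> x y)" and semi: "ext_semimetric \<rho>"
    and \<mu>: "prob_space \<mu>" "sets \<mu> = sets borel" and \<nu>: "prob_space \<nu>" "sets \<nu> = sets borel"
    and lip: "\<And>f :: 'e \<Rightarrow> real. f \<in> borel_measurable borel \<Longrightarrow> bounded (range f) \<Longrightarrow>
      (\<And>x y. ennreal (f x - f y) \<le> \<rho> x y) \<Longrightarrow> integral\<^sup>L \<mu> f - integral\<^sup>L \<nu> f \<le> L"
  shows "\<exists>\<pi>\<in>couplings \<mu> \<nu>. (\<integral>\<^sup>+z. \<rho> (fst z) (snd z) \<partial>\<pi>) \<le> ennreal L"
proof -
  obtain \<B> :: "'e set set" where \<B>: "countable \<B>" "topological_basis \<B>"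
    using ex_countable_basis by blast
  have "\<B> \<noteq> {}"
    using topological_basisE[OF \<B>(2) open_UNIV UNIV_I] by blast
  define U where "U = from_nat_into \<B>"
  have base: "topological_basis (range U)"
    using \<B> \<open>\<B> \<noteq> {}\<close> by (simp add: U_def range_from_nat_into)
  have U_open: "open (U i)" for i
    using topological_basis_open[OF base] by auto
  then have U: "U i \<in> sets borel" for i by simp
  have U_\<mu>: "U i \<in> sets \<mu>" and U_\<nu>: "U i \<in> sets \<nu>" for i using U \<mu>(2) \<nu>(2) by auto
  obtain D :: "(nat \<Rightarrow> bool) \<Rightarrow> 'e"
    where D: "D \<in> PiM UNIV (\<lambda>_. count_space UNIV) \<rightarrow>\<^sub>M borel" "\<And>x. D (\<lambda>i. x \<in> U i) = x"
    using measurable_decoding[OF base] by blast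
  define A where "A = (\<lambda>n. SOME p. measure_pmf p = distr \<mu> (count_space UNIV) (code U n))"
  define B where "B = (\<lambda>n. SOME p. measure_pmf p = distr \<nu> (count_space UNIV) (code U n))"
  have A: "measure_pmf (A n) = distr \<mu> (count_space UNIV) (code U n)" for n
    unfolding A_def by (rule someI_ex) (rule code_law_pmf[OF \<mu>(1) U_\<mu>])
  have B: "measure_pmf (B n) = distr \<nu> (count_space UNIV) (code U n)" for n
    unfolding B_def by (rule someI_ex) (rule code_law_pmf[OF \<nu>(1) U_\<nu>])
  define I where "I = (\<lambda>n. {\<sigma> :: bool list. length \<sigma> = n})"
  have fin_I: "finite (I n)" for n
    using finite_lists_length_eq[of "UNIV :: bool set" n] by (simp add: I_def)
  have supp: "set_pmf (A n) \<subseteq> I n" "set_pmf (B n) \<subseteq> I n" for n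
  proof -
    have "AE \<sigma> in measure_pmf (A n). \<sigma> \<in> I n"
      unfolding A by (subst AE_distr_iff) (auto intro!: measurable_code U_\<mu> simp: I_def)
    then show "set_pmf (A n) \<subseteq> I n" by (auto simp: AE_measure_pmf_iff)
    have "AE \<sigma> in measure_pmf (B n). \<sigma> \<in> I n"
      unfolding B by (subst AE_distr_iff) (auto intro!: measurable_code U_\<nu> simp: I_def)
    then show "set_pmf (B n) \<subseteq> I n" by (auto simp: AE_measure_pmf_iff)
  qed
  define c where "c = (\<lambda>n \<sigma> \<tau>. enn2real (cell_cost U \<rho> n \<sigma> \<tau>))"
  have c_ennreal: "ennreal (c n \<sigma> \<tau>) = cell_cost U \<rho> n \<sigma> \<tau>" for n \<sigma> \<tau>
    unfolding c_def using cell_cost_finite by (rule ennreal_enn2real)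
  have c0: "0 \<le> c n \<sigma> \<tau>" for n \<sigma> \<tau> by (simp add: c_def)
  have c_le: "c n \<sigma> \<tau> \<le> real n" for n \<sigma> \<tau>
    unfolding c_def using cell_cost_le_of_nat[of U \<rho> n \<sigma> \<tau>]
    by (intro enn2real_leI) (auto simp: ennreal_of_nat_eq_real_of_nat)
  have c_mono: "c n (take n \<sigma>) (take n \<tau>) \<le> c m \<sigma> \<tau>" if "n \<le> m" for n m \<sigma> \<tau>
    unfolding c_def by (intro enn2real_mono cell_cost_mono that cell_cost_finite)
  have "\<exists>q. map_pmf fst q = A n \<and> map_pmf snd q = B n \<and>
    measure_pmf.expectation q (\<lambda>z. c n (fst z) (snd z)) \<le> L" for n
  proof (rule finite_transport_duality[OF fin_I fin_I supp c0])
    fix \<phi> \<psi> :: "bool list \<Rightarrow> real"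
    assume le: "\<And>\<sigma> \<tau>. \<sigma> \<in> I n \<Longrightarrow> \<tau> \<in> I n \<Longrightarrow> \<phi> \<sigma> + \<psi> \<tau> \<le> c n \<sigma> \<tau>"
    have "(\<integral>x. \<phi> (code U n x) \<partial>\<mu>) + (\<integral>x. \<psi> (code U n x) \<partial>\<nu>) \<le> L"
    proof (rule simple_dual_bound[OF lsc semi \<mu> \<nu> lip])
      show "(\<lambda>x. \<phi> (code U n x)) \<in> borel_measurable borel" "(\<lambda>x. \<psi> (code U n x)) \<in> borel_measurable borel"
        by (rule measurable_compose[OF measurable_code[OF U]], simp)+
      have "range (code U n) \<subseteq> I n" by (auto simp: I_def)
      then have "finite (range (code U n))" using fin_I by (rule finite_subset)
      then show "finite (range (\<lambda>x. \<phi> (code U n x)))" "finite (range (\<lambda>x. \<psi> (code U n x)))"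
        by (metis finite_imageI image_image)+
      fix x y
      have "ennreal (\<phi> (code U n x) + \<psi> (code U n y)) \<le> cell_cost U \<rho> n (code U n x) (code U n y)"
        using le[of "code U n x" "code U n y"] by (simp add: I_def c_ennreal[symmetric] ennreal_leI)
      also have "\<dots> \<le> \<rho> x y" by (rule cell_cost_code_le)
      finally show "ennreal (\<phi> (code U n x) + \<psi> (code U n y)) \<le> \<rho> x y" .
    qed
    then show "measure_pmf.expectation (A n) \<phi> + measure_pmf.expectation (B n) \<psi> \<le> L"
      unfolding A B using U_\<mu> U_\<nu> by (simp add: integral_distr measurable_code)
  qed
  then obtain q where q: "\<And>n. map_pmf fst (q n) = A n" "\<And>n. map_pmf snd (q n) = B n"
    "\<And>n. measure_pmf.expectation (q n) (\<lambda>z. c n (fst z) (snd z)) \<le> L" by metis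
  have len: "length (fst z) = n" "length (snd z) = n" if "z \<in> set_pmf (q n)" for z n
  proof -
    have "fst z \<in> set_pmf (A n)" "snd z \<in> set_pmf (B n)"
      using that by (auto simp flip: q(1,2))
    then show "length (fst z) = n" "length (snd z) = n" using supp by (auto simp: I_def)
  qed
  define b where "b = (\<lambda>(i :: nat + nat) (z :: bool list \<times> bool list). case i of
    Inl i \<Rightarrow> fst z ! i | Inr i \<Rightarrow> snd z ! i)"
  have pred_b: "Measurable.pred (measure_pmf (q m)) (b i)" for m i by simp
  obtain r :: "nat \<Rightarrow> nat" and M :: "real measure" and b' :: "nat + nat \<Rightarrow> real \<Rightarrow> bool"
    where r: "strict_mono r" and M: "prob_space M" and b'[measurable]: "\<And>i. Measurable.pred M (b' i)"
    and lim: "\<And>J \<sigma>. finite J \<Longrightarrow>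
      (\<lambda>k. measure (q (r k)) {z \<in> space (q (r k)). \<forall>i\<in>J. b i z = \<sigma> i})
        \<longlonglongrightarrow> measure M {\<omega> \<in> space M. \<forall>i\<in>J. b' i \<omega> = \<sigma> i}"
  proof (rule subsequence_limit_of_bits[of "\<lambda>n. measure_pmf (q n)" b, OF measure_pmf.prob_space_axioms pred_b])
    fix r :: "nat \<Rightarrow> nat" and M :: "real measure" and b' :: "nat + nat \<Rightarrow> real \<Rightarrow> bool"
    assume "strict_mono r" "prob_space M" "\<And>i. Measurable.pred M (b' i)"
      "\<And>J \<sigma>. finite J \<Longrightarrow>
        (\<lambda>k. measure (q (r k)) {z \<in> space (q (r k)). \<forall>i\<in>J. b i z = \<sigma> i})
          \<longlonglongrightarrow> measure M {\<omega> \<in> space M. \<forall>i\<in>J. b' i \<omega> = \<sigma> i}"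
    then show thesis by (rule that)
  qed
  interpret M: prob_space M by (rule M)
  have r_ge: "n \<le> r k" if "n \<le> k" for n k
    using that seq_suble[OF r, of k] by simp
  define K where "K = (\<lambda>n \<omega>. map (\<lambda>i. b' (Inl i) \<omega>) [0..<n])"
  define K' where "K' = (\<lambda>n \<omega>. map (\<lambda>i. b' (Inr i) \<omega>) [0..<n])"
  have K_meas[measurable]: "K n \<in> M \<rightarrow>\<^sub>M count_space UNIV" "K' n \<in> M \<rightarrow>\<^sub>M count_space UNIV" for n
    unfolding K_def K'_def by (intro measurable_map_upt b')+
  (* Both marginals of the limit are found alike: h selects the bits of one coordinate,
     pr projects the plans to it, and the pattern probabilities of level n are constant
     along the subsequence from r k >= n on. *)
  have marginal: "distr M (count_space UNIV) (\<lambda>\<omega>. map (\<lambda>i. b' (h i) \<omega>) [0..<n])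
      = distr \<kappa> (count_space UNIV) (code U n)"
    if h: "inj h" "\<And>i z. b (h i) z = pr z ! i" and pr: "\<And>m. measure_pmf (map_pmf pr (q m)) = distr \<kappa> (count_space UNIV) (code U m)"
      and \<kappa>: "prob_space \<kappa>" "\<And>i. U i \<in> sets \<kappa>" for h :: "nat \<Rightarrow> nat + nat" and pr \<kappa> n
  proof (rule measure_eqI_countable[of _ UNIV])
    interpret \<kappa>: prob_space \<kappa> by fact
    note [measurable] = \<kappa>(2)
    have cm: "code U m \<in> \<kappa> \<rightarrow>\<^sub>M count_space UNIV" for m by (intro measurable_code \<kappa>(2))
    have bm: "(\<lambda>\<omega>. map (\<lambda>i. b' (h i) \<omega>) [0..<n]) \<in> M \<rightarrow>\<^sub>M count_space UNIV"
      by (intro measurable_map_upt b')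
    fix \<sigma> :: "bool list"
    have "measure M {\<omega> \<in> space M. map (\<lambda>i. b' (h i) \<omega>) [0..<n] = \<sigma>} = measure \<kappa> {x \<in> space \<kappa>. code U n x = \<sigma>}"
    proof (cases "length \<sigma> = n")
      case True
      have "(\<lambda>k. measure (q (r k)) {z. \<forall>i<n. pr z ! i = \<sigma> ! i})
          \<longlonglongrightarrow> measure M {\<omega> \<in> space M. \<forall>i<n. b' (h i) \<omega> = \<sigma> ! i}"
        using lim[of "h ` {..<n}" "\<lambda>i. \<sigma> ! the_inv h i"]
        by (simp add: the_inv_f_f[OF h(1)] h(2) Ball_def[symmetric] lessThan_iff[symmetric] del: lessThan_iff)
      moreover have "measure (q (r k)) {z. \<forall>i<n. pr z ! i = \<sigma> ! i} = measure \<kappa> {x \<in> space \<kappa>. code U n x = \<sigma>}"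
        if "n \<le> k" for k
      proof -
        have "measure (q (r k)) {z. \<forall>i<n. pr z ! i = \<sigma> ! i} = measure (map_pmf pr (q (r k))) {\<tau>. \<forall>i<n. \<tau> ! i = \<sigma> ! i}"
          by (simp add: vimage_def)
        also have "\<dots> = measure \<kappa> {x \<in> space \<kappa>. \<forall>i<n. code U (r k) x ! i = \<sigma> ! i}"
          unfolding pr by (subst measure_distr[OF cm]) (auto intro!: arg_cong[of _ _ "measure \<kappa>"])
        also have "{x \<in> space \<kappa>. \<forall>i<n. code U (r k) x ! i = \<sigma> ! i} = {x \<in> space \<kappa>. code U n x = \<sigma>}"
          using True r_ge[OF that] by (auto simp: list_eq_iff_nth_eq nth_code)
        finally show ?thesis .
      qed
      ultimately have "measure M {\<omega> \<in> space M. \<forall>i<n. b' (h i) \<omega> = \<sigma> ! i} = measure \<kappa> {x \<in> space \<kappa>. code U n x = \<sigma>}"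
        by (intro LIMSEQ_unique[OF _ tendsto_eventually]) (auto simp: eventually_sequentially)
      then show ?thesis using True by (simp add: map_upt_eq_iff)
    next
      case False
      then have "code U n x \<noteq> \<sigma>" "map (\<lambda>i. b' (h i) \<omega>) [0..<n] \<noteq> \<sigma>" for x \<omega> by auto
      then show ?thesis by simp
    qed
    then show "emeasure (distr M (count_space UNIV) (\<lambda>\<omega>. map (\<lambda>i. b' (h i) \<omega>) [0..<n])) {\<sigma>}
      = emeasure (distr \<kappa> (count_space UNIV) (code U n)) {\<sigma>}"
      using cm bm by (simp add: emeasure_distr M.emeasure_eq_measure \<kappa>.emeasure_eq_measure vimage_def Int_def conj_commute)
  qed auto
  define X where "X = (\<lambda>\<omega>. D (\<lambda>i. b' (Inl i) \<omega>))"
  define Y where "Y = (\<lambda>\<omega>. D (\<lambda>i. b' (Inr i) \<omega>))"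
  have mX: "distr M (count_space UNIV) (\<lambda>\<omega>. map (\<lambda>i. b' (Inl i) \<omega>) [0..<n])
      = distr \<mu> (count_space UNIV) (code U n)" for n
    by (rule marginal[of Inl fst]) (auto simp: b_def q A \<mu>(1) U_\<mu>)
  have mY: "distr M (count_space UNIV) (\<lambda>\<omega>. map (\<lambda>i. b' (Inr i) \<omega>) [0..<n])
      = distr \<nu> (count_space UNIV) (code U n)" for n
    by (rule marginal[of Inr snd]) (auto simp: b_def q B \<nu>(1) U_\<nu>)
  have X: "distr M borel X = \<mu>" "AE \<omega> in M. \<forall>i. b' (Inl i) \<omega> \<longleftrightarrow> X \<omega> \<in> U i"
    unfolding X_def by (rule decode_law[OF U D \<mu> M b' mX])+
  have Y: "distr M borel Y = \<nu>" "AE \<omega> in M. \<forall>i. b' (Inr i) \<omega> \<longleftrightarrow> Y \<omega> \<in> U i"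
    unfolding Y_def by (rule decode_law[OF U D \<nu> M b' mY])+
  have XY_meas[measurable]: "X \<in> M \<rightarrow>\<^sub>M borel" "Y \<in> M \<rightarrow>\<^sub>M borel"
    unfolding X_def Y_def by (rule measurable_compose[OF _ D(1)], rule measurable_PiM_single', auto simp: b')+
  (* The level-n cost of the plan of a finer level is at most its own cost, hence at most L. *)
  have cost: "(\<integral>\<omega>. c n (K n \<omega>) (K' n \<omega>) \<partial>M) \<le> L" for n
  proof (rule LIMSEQ_le_const2)
    define e where "e = (\<lambda>m. measure_pmf.expectation (q m) (\<lambda>z. c n (take n (fst z)) (take n (snd z))))"
    have fin2: "finite (I n \<times> I n)" using fin_I by simp
    have "(\<integral>\<omega>. c n (K n \<omega>) (K' n \<omega>) \<partial>M) = (\<integral>\<omega>. (\<lambda>s. c n (fst s) (snd s)) (K n \<omega>, K' n \<omega>) \<partial>M)"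
      by simp
    also have "\<dots> = (\<Sum>s\<in>I n \<times> I n. c n (fst s) (snd s) * measure M {\<omega> \<in> space M. (K n \<omega>, K' n \<omega>) = s})"
      by (rule integral_finite_valued[OF M measurable_Pair_count_space[OF K_meas] fin2])
        (auto simp: I_def K_def K'_def)
    finally have EM: "(\<integral>\<omega>. c n (K n \<omega>) (K' n \<omega>) \<partial>M) = \<dots>" .
    have Eq: "e m = (\<Sum>s\<in>I n \<times> I n. c n (fst s) (snd s) *
        measure (q m) {z. (take n (fst z), take n (snd z)) = s})" if "n \<le> m" for m
    proof -
      have "e m = (\<integral>z. (\<lambda>s. c n (fst s) (snd s)) (take n (fst z), take n (snd z)) \<partial>q m)"
        by (simp add: e_def)
      also have "\<dots> = (\<Sum>s\<in>I n \<times> I n. c n (fst s) (snd s) *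
          measure (q m) {z \<in> space (q m). (take n (fst z), take n (snd z)) = s})"
        using that len by (intro integral_finite_valued measure_pmf.prob_space_axioms fin2)
          (auto simp: I_def AE_measure_pmf_iff)
      finally show ?thesis by simp
    qed
    have "(\<lambda>k. measure (q (r k)) {z. (take n (fst z), take n (snd z)) = s})
        \<longlonglongrightarrow> measure M {\<omega> \<in> space M. (K n \<omega>, K' n \<omega>) = s}" if s: "s \<in> I n \<times> I n" for s
    proof -
      have ls: "length (fst s) = n" "length (snd s) = n" using s by (auto simp: I_def)
      let ?J = "Inl ` {..<n} \<union> Inr ` {..<n} :: (nat + nat) set"
      let ?\<sigma> = "case_sum (\<lambda>i. fst s ! i) (\<lambda>i. snd s ! i)"
      have "(\<lambda>k. measure (q (r k)) {z \<in> space (q (r k)). \<forall>i\<in>?J. b i z = ?\<sigma> i})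
        \<longlonglongrightarrow> measure M {\<omega> \<in> space M. \<forall>i\<in>?J. b' i \<omega> = ?\<sigma> i}"
        by (rule lim) simp
      also have "{\<omega> \<in> space M. \<forall>i\<in>?J. b' i \<omega> = ?\<sigma> i} = {\<omega> \<in> space M. (K n \<omega>, K' n \<omega>) = s}"
        using ls by (cases s) (auto simp: K_def K'_def map_upt_eq_iff ball_Un)
      finally have *: "(\<lambda>k. measure (q (r k)) {z \<in> space (q (r k)). \<forall>i\<in>?J. b i z = ?\<sigma> i})
        \<longlonglongrightarrow> measure M {\<omega> \<in> space M. (K n \<omega>, K' n \<omega>) = s}" .
      have "measure (q (r k)) {z \<in> space (q (r k)). \<forall>i\<in>?J. b i z = ?\<sigma> i}
        = measure (q (r k)) {z. (take n (fst z), take n (snd z)) = s}" if "n \<le> k" for k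
      proof (rule measure_pmf.finite_measure_eq_AE)
        show "AE z in q (r k). z \<in> {z \<in> space (q (r k)). \<forall>i\<in>?J. b i z = ?\<sigma> i}
          \<longleftrightarrow> z \<in> {z. (take n (fst z), take n (snd z)) = s}"
        proof (rule AE_pmfI)
          fix z assume "z \<in> set_pmf (q (r k))"
          from len[OF this] have "length (fst z) \<ge> n" "length (snd z) \<ge> n" using r_ge[OF that] by auto
          then show "z \<in> {z \<in> space (q (r k)). \<forall>i\<in>?J. b i z = ?\<sigma> i}
            \<longleftrightarrow> z \<in> {z. (take n (fst z), take n (snd z)) = s}"
            using ls by (cases s) (auto simp: b_def list_eq_iff_nth_eq ball_Un)
        qed
      qed auto
      then show ?thesis
        by (intro Lim_transform_eventually[OF *]) (auto simp: eventually_sequentially)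
    qed
    then have "(\<lambda>k. \<Sum>s\<in>I n \<times> I n. c n (fst s) (snd s) *
        measure (q (r k)) {z. (take n (fst z), take n (snd z)) = s})
        \<longlonglongrightarrow> (\<integral>\<omega>. c n (K n \<omega>) (K' n \<omega>) \<partial>M)"
      unfolding EM by (intro tendsto_sum tendsto_mult tendsto_const)
    then show "(\<lambda>k. e (r k)) \<longlonglongrightarrow> (\<integral>\<omega>. c n (K n \<omega>) (K' n \<omega>) \<partial>M)"
      using Eq r_ge by (elim Lim_transform_eventually) (auto simp: eventually_sequentially intro!: exI[of _ n])
    have "e (r k) \<le> L" if "n \<le> k" for k
    proof -
      have "e (r k) \<le> measure_pmf.expectation (q (r k)) (\<lambda>z. c (r k) (fst z) (snd z))"
        unfolding e_def
      proof (rule integral_mono)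
        show "integrable (q (r k)) (\<lambda>z. c n (take n (fst z)) (take n (snd z)))"
          using c0 c_le by (intro measure_pmf.integrable_const_bound[of _ "real n"]) auto
        show "integrable (q (r k)) (\<lambda>z. c (r k) (fst z) (snd z))"
          using c0 c_le by (intro measure_pmf.integrable_const_bound[of _ "real (r k)"]) auto
      qed (rule c_mono[OF r_ge[OF that]])
      then show ?thesis using q(3) by (rule order_trans)
    qed
    then show "\<exists>N. \<forall>k\<ge>N. e (r k) \<le> L" by blast
  qed
  have cost': "(\<integral>\<^sup>+\<omega>. cell_cost U \<rho> n (code U n (X \<omega>)) (code U n (Y \<omega>)) \<partial>M) \<le> ennreal L" for n
  proof -
    have "(\<integral>\<^sup>+\<omega>. cell_cost U \<rho> n (code U n (X \<omega>)) (code U n (Y \<omega>)) \<partial>M) = (\<integral>\<^sup>+\<omega>. ennreal (c n (K n \<omega>) (K' n \<omega>)) \<partial>M)"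
    proof (rule nn_integral_cong_AE)
      show "AE \<omega> in M. cell_cost U \<rho> n (code U n (X \<omega>)) (code U n (Y \<omega>)) = ennreal (c n (K n \<omega>) (K' n \<omega>))"
        using X(2) Y(2)
      proof eventually_elim
        case (elim \<omega>)
        then have "K n \<omega> = code U n (X \<omega>)" "K' n \<omega> = code U n (Y \<omega>)"
          by (simp_all add: K_def K'_def code_def)
        then show ?case by (simp add: c_ennreal)
      qed
    qed
    also have "\<dots> = ennreal (\<integral>\<omega>. c n (K n \<omega>) (K' n \<omega>) \<partial>M)"
    proof (rule nn_integral_eq_integral)
      have "(\<lambda>\<omega>. (\<lambda>s. c n (fst s) (snd s)) (K n \<omega>, K' n \<omega>)) \<in> borel_measurable M"
        by (rule measurable_compose[OF measurable_Pair_count_space[OF K_meas]]) simp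
      then show "integrable M (\<lambda>\<omega>. c n (K n \<omega>) (K' n \<omega>))"
        using c0 c_le by (intro M.integrable_const_bound[of _ "real n"]) auto
    qed (simp add: c0)
    also have "\<dots> \<le> ennreal L" using cost by (rule ennreal_leI)
    finally show ?thesis .
  qed
  define \<pi> where "\<pi> = distr M (borel \<Otimes>\<^sub>M borel) (\<lambda>\<omega>. (X \<omega>, Y \<omega>))"
  have "\<pi> \<in> couplings \<mu> \<nu>"
    unfolding couplings_def \<pi>_def using X(1) Y(1) by (simp add: distr_distr comp_def)
  moreover have "(\<integral>\<^sup>+z. \<rho> (fst z) (snd z) \<partial>\<pi>) \<le> ennreal L"
  proof -
    have "(\<integral>\<^sup>+z. \<rho> (fst z) (snd z) \<partial>\<pi>) = (\<integral>\<^sup>+\<omega>. \<rho> (X \<omega>) (Y \<omega>) \<partial>M)"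
      unfolding \<pi>_def using borel_measurable_lower_semicontinuous[OF lsc]
      by (subst nn_integral_distr) auto
    also have "\<dots> = (\<integral>\<^sup>+\<omega>. (SUP n. cell_cost U \<rho> n (code U n (X \<omega>)) (code U n (Y \<omega>))) \<partial>M)"
      by (simp add: SUP_cell_cost[OF base lsc])
    also have "\<dots> = (SUP n. \<integral>\<^sup>+\<omega>. cell_cost U \<rho> n (code U n (X \<omega>)) (code U n (Y \<omega>)) \<partial>M)"
    proof (rule nn_integral_monotone_convergence_SUP)
      show "incseq (\<lambda>n \<omega>. cell_cost U \<rho> n (code U n (X \<omega>)) (code U n (Y \<omega>)))"
      proof (intro incseq_SucI le_funI)
        fix n \<omega>
        show "cell_cost U \<rho> n (code U n (X \<omega>)) (code U n (Y \<omega>))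
          \<le> cell_cost U \<rho> (Suc n) (code U (Suc n) (X \<omega>)) (code U (Suc n) (Y \<omega>))"
          using cell_cost_mono[of n "Suc n" U \<rho> "code U (Suc n) (X \<omega>)" "code U (Suc n) (Y \<omega>)"]
          by (simp add: take_code)
      qed
      fix n
      have code_meas: "(\<lambda>\<omega>. code U n (X \<omega>)) \<in> M \<rightarrow>\<^sub>M count_space UNIV" "(\<lambda>\<omega>. code U n (Y \<omega>)) \<in> M \<rightarrow>\<^sub>M count_space UNIV"
        using measurable_compose[OF XY_meas(1) measurable_code[OF U]] measurable_compose[OF XY_meas(2) measurable_code[OF U]]
        by auto
      have "(\<lambda>\<omega>. (\<lambda>s. cell_cost U \<rho> n (fst s) (snd s)) (code U n (X \<omega>), code U n (Y \<omega>))) \<in> borel_measurable M"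
        by (rule measurable_compose[OF measurable_Pair_count_space[OF code_meas]]) simp
      then show "(\<lambda>\<omega>. cell_cost U \<rho> n (code U n (X \<omega>)) (code U n (Y \<omega>))) \<in> borel_measurable M" by simp
    qed
    also have "\<dots> \<le> ennreal L" by (intro SUP_least cost')
    finally show ?thesis .
  qed
  ultimately show ?thesis by blast
qed

section \<open>Lipschitz bounds and the semigroup\<close>

definition lipschitz_bound :: "('e \<Rightarrow> 'e \<Rightarrow> ennreal) \<Rightarrow> real \<Rightarrow> ('e \<Rightarrow> real) \<Rightarrow> bool" where
  "lipschitz_bound \<rho> r f \<longleftrightarrow> (\<forall>x y. ennreal (f x - f y) \<le> ennreal r * \<rho> x y)"

lemma lipschitz_boundD: "lipschitz_bound \<rho> r f \<Longrightarrow> ennreal (f x - f y) \<le> ennreal r * \<rho> x y"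
  by (simp add: lipschitz_bound_def)

lemma lipschitz_bound_mono: "lipschitz_bound \<rho> r f \<Longrightarrow> r \<le> s \<Longrightarrow> lipschitz_bound \<rho> s f"
  unfolding lipschitz_bound_def by (meson ennreal_leI mult_right_mono order_trans zero_le)

lemma lipschitz_bound_scale:
  assumes "lipschitz_bound \<rho> r f" "0 \<le> a"
  shows "lipschitz_bound \<rho> (a * r) (\<lambda>x. a * f x)"
  unfolding lipschitz_bound_def
proof safe
  fix x y
  have "ennreal (a * f x - a * f y) = ennreal a * ennreal (f x - f y)"
    using assms(2) by (simp add: ennreal_mult' right_diff_distrib flip: ennreal_mult')
  also have "\<dots> \<le> ennreal a * (ennreal r * \<rho> x y)"
    using assms(1) by (intro mult_left_mono lipschitz_boundD) auto
  finally show "ennreal (a * f x - a * f y) \<le> ennreal (a * r) * \<rho> x y"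
    using assms(2) by (simp add: ennreal_mult' mult.assoc)
qed

lemma lip_norm_leI: "lipschitz_bound \<rho> r f \<Longrightarrow> 0 \<le> r \<Longrightarrow> lip_norm \<rho> f \<le> ennreal r"
  unfolding lip_norm_def lipschitz_bound_def by (rule Inf_lower) blast

text \<open>
  The bound holds for every \<open>s > r\<close>. At finite distance let \<open>s\<close> decrease to \<open>r\<close>; at infinite distance
  it is trivial because \<open>r > 0\<close>. For \<open>r = 0\<close> the conclusion can fail: a function of norm \<open>0\<close> may
  differ at points of infinite distance, whereas \<open>0 * \<infinity> = 0\<close>.
\<close>

lemma lip_norm_leD:
  assumes "lip_norm \<rho> f \<le> ennreal r" "0 < r"
  shows "lipschitz_bound \<rho> r f"
  unfolding lipschitz_bound_def
proof safe
  fix x y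
  have le: "ennreal (f x - f y) \<le> ennreal s * \<rho> x y" if "r < s" for s
  proof -
    have "lip_norm \<rho> f < ennreal s"
      using assms that by (metis ennreal_lessI le_less_trans less_trans)
    then obtain u where u: "ennreal u < ennreal s" "0 \<le> u" "\<forall>x y. ennreal (f x - f y) \<le> ennreal u * \<rho> x y"
      unfolding lip_norm_def Inf_less_iff by auto
    have "ennreal (f x - f y) \<le> ennreal u * \<rho> x y" using u by blast
    also have "\<dots> \<le> ennreal s * \<rho> x y" using u by (intro mult_right_mono) auto
    finally show ?thesis .
  qed
  show "ennreal (f x - f y) \<le> ennreal r * \<rho> x y"
  proof (cases "\<rho> x y")
    case (real d)
    have "f x - f y \<le> r * d"
    proof (rule field_le_epsilon)
      fix e :: real assume e: "0 < e"
      have "ennreal (f x - f y) \<le> ennreal (r + e / (d + 1)) * ennreal d"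
        using le[of "r + e / (d + 1)"] e real by simp
      also have "\<dots> = ennreal ((r + e / (d + 1)) * d)"
        using real by (simp add: ennreal_mult'')
      finally have "f x - f y \<le> (r + e / (d + 1)) * d"
        using real e assms(2) by (subst (asm) ennreal_le_iff) auto
      also have "\<dots> \<le> r * d + e" using e real by (simp add: field_simps)
      finally show "f x - f y \<le> r * d + e" .
    qed
    then have "ennreal (f x - f y) \<le> ennreal (r * d)" by (rule ennreal_leI)
    then show ?thesis using real by (simp add: ennreal_mult'')
  next
    case top
    then show ?thesis using assms(2) by (simp add: ennreal_mult_top)
  qed
qed

lemma ennreal_integral_le_nn_integral: "ennreal (integral\<^sup>L M f) \<le> (\<integral>\<^sup>+x. ennreal (f x) \<partial>M)"
proof (cases "integrable M f")
  case True
  have "ennreal (integral\<^sup>L M f) \<le> ennreal (\<integral>x. max 0 (f x) \<partial>M)"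
    using True by (intro ennreal_leI integral_mono) auto
  also have "\<dots> = (\<integral>\<^sup>+x. ennreal (max 0 (f x)) \<partial>M)"
    using True by (intro nn_integral_eq_integral[symmetric]) auto
  finally show ?thesis by (simp add: ennreal_max_0')
qed (simp add: not_integrable_integral_eq)

lemma lipschitz_integral_diff_le_cost:
  assumes \<pi>: "\<pi> \<in> couplings \<mu> \<nu>"
    and f: "f \<in> borel_measurable borel" "integrable \<mu> f" "integrable \<nu> f"
    and lip: "lipschitz_bound \<rho> 1 f"
  shows "ennreal (integral\<^sup>L \<mu> f - integral\<^sup>L \<nu> f) \<le> (\<integral>\<^sup>+z. \<rho> (fst z) (snd z) \<partial>\<pi>)"
proof -
  have sets: "sets \<pi> = sets (borel \<Otimes>\<^sub>M borel)"
    and marg: "distr \<pi> borel fst = \<mu>" "distr \<pi> borel snd = \<nu>"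
    using \<pi> by (auto simp: couplings_def)
  have m: "fst \<in> \<pi> \<rightarrow>\<^sub>M borel" "snd \<in> \<pi> \<rightarrow>\<^sub>M borel"
    using sets by (simp_all add: measurable_cong_sets[OF sets refl])
  have i: "integrable \<pi> (\<lambda>z. f (fst z))" "integrable \<pi> (\<lambda>z. f (snd z))"
    using f(2,3) unfolding marg[symmetric] integrable_distr_eq[OF m(1) f(1)] integrable_distr_eq[OF m(2) f(1)]
    by auto
  have "integral\<^sup>L \<mu> f - integral\<^sup>L \<nu> f = (\<integral>z. f (fst z) - f (snd z) \<partial>\<pi>)"
    using i f(1) m unfolding marg[symmetric] by (simp add: integral_distr)
  then have "ennreal (integral\<^sup>L \<mu> f - integral\<^sup>L \<nu> f) \<le> (\<integral>\<^sup>+z. ennreal (f (fst z) - f (snd z)) \<partial>\<pi>)"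
    using ennreal_integral_le_nn_integral by simp
  also have "\<dots> \<le> (\<integral>\<^sup>+z. \<rho> (fst z) (snd z) \<partial>\<pi>)"
    using lipschitz_boundD[OF lip] by (intro nn_integral_mono) simp
  finally show ?thesis .
qed

text \<open>
  The substitute for \<open>\<parallel>S\<^sub>t\<parallel> \<le> r\<close> used below. Restricting to bounded test functions makes the
  semigroup property available (a Lipschitz function that is integrable under the laws at time \<open>t\<close>
  need not be integrable at earlier times), and for a contraction these functions already determine
  the norm when \<open>r > 0\<close>.
\<close>

definition lipschitz_contracts ::
  "('e::topological_space \<Rightarrow> 'e \<Rightarrow> ennreal) \<Rightarrow> ('e \<Rightarrow> 'w measure) \<Rightarrow> (real \<Rightarrow> 'w \<Rightarrow> 'e) \<Rightarrow> real \<Rightarrow> real \<Rightarrow> bool"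
  where
  "lipschitz_contracts \<rho> P X r t \<longleftrightarrow> (\<forall>f \<in> borel_measurable borel. bounded (range f) \<longrightarrow>
     lipschitz_bound \<rho> 1 f \<longrightarrow> lipschitz_bound \<rho> r (transition_semigroup P X t f))"

lemma lipschitz_contractsD:
  assumes "lipschitz_contracts \<rho> P X r t" "f \<in> borel_measurable borel" "bounded (range f)"
    and "lipschitz_bound \<rho> s f" "0 < s"
  shows "lipschitz_bound \<rho> (s * r) (transition_semigroup P X t f)"
proof -
  have "lipschitz_bound \<rho> 1 (\<lambda>x. (1 / s) * f x)"
    using lipschitz_bound_scale[OF assms(4), of "1 / s"] assms(5) by simp
  moreover have "bounded (range (\<lambda>x. (1 / s) * f x))"
    using bounded_scaling[OF assms(3), of "1 / s"] by (simp add: image_image)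
  ultimately have "lipschitz_bound \<rho> r (transition_semigroup P X t (\<lambda>x. (1 / s) * f x))"
    using assms(1,2) unfolding lipschitz_contracts_def by simp
  from lipschitz_bound_scale[OF this, of s] show ?thesis
    using assms(5) by (simp add: transition_semigroup_def[abs_def])
qed

context feller_process
begin

lemma
  shows prob_space_P: "prob_space (P x)" and sets_P: "sets (P x) = sets \<Omega>" and space_P: "space (P x) = space \<Omega>"
proof -
  have "P x \<in> space (prob_algebra \<Omega>)"
    using measurable_space[OF kernel, of x] by simp
  then show "prob_space (P x)" "sets (P x) = sets \<Omega>" by (auto simp: space_prob_algebra)
  then show "space (P x) = space \<Omega>" by (intro sets_eq_imp_space_eq)
qed

lemma X_measurable_P: "0 \<le> t \<Longrightarrow> X t \<in> P x \<rightarrow>\<^sub>M borel"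
  using X_measurable measurable_cong_sets[OF sets_P refl] by auto

lemma integral_law:
  assumes "0 \<le> t" "f \<in> borel_measurable borel"
  shows "integral\<^sup>L (law P X t x) f = transition_semigroup P X t f x"
  unfolding law_def transition_semigroup_def using assms X_measurable_P by (simp add: integral_distr)

lemma integrable_P:
  fixes f :: "'e \<Rightarrow> real"
  assumes "0 \<le> t" "f \<in> borel_measurable borel" "bounded (range f)"
  shows "integrable (P x) (\<lambda>\<omega>. f (X t \<omega>))"
proof -
  interpret prob_space "P x" by (rule prob_space_P)
  obtain C where "\<And>x. norm (f x) \<le> C" using assms(3) by (auto simp: bounded_iff)
  then show ?thesis
    using measurable_compose[OF X_measurable_P[OF assms(1)] assms(2)]
    by (intro integrable_const_bound[of _ C]) auto
qed

lemma semigroup_bounded: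
  fixes f :: "'e \<Rightarrow> real"
  assumes "0 \<le> t" "f \<in> borel_measurable borel" "bounded (range f)"
  shows "bounded (range (transition_semigroup P X t f))"
proof -
  obtain C where C: "\<And>x. norm (f x) \<le> C" using assms(3) by (auto simp: bounded_iff)
  have "norm (transition_semigroup P X t f x) \<le> C" for x
  proof -
    interpret prob_space "P x" by (rule prob_space_P)
    have "norm (transition_semigroup P X t f x) \<le> (\<integral>\<omega>. norm (f (X t \<omega>)) \<partial>P x)"
      unfolding transition_semigroup_def by (rule integral_norm_bound)
    also have "\<dots> \<le> (\<integral>\<omega>. C \<partial>P x)"
      using integrable_P[OF assms] C by (intro integral_mono) auto
    finally show ?thesis by (simp add: prob_space)
  qed
  then show ?thesis by (auto simp: bounded_iff)
qed

lemma semigroup_measurable: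
  fixes f :: "'e \<Rightarrow> real"
  assumes "0 \<le> t" "f \<in> borel_measurable borel"
  shows "transition_semigroup P X t f \<in> borel_measurable borel"
proof -
  have "P \<in> borel \<rightarrow>\<^sub>M subprob_algebra \<Omega>" using kernel by (rule measurable_prob_algebraD)
  moreover have "(\<lambda>\<omega>. f (X t \<omega>)) \<in> borel_measurable \<Omega>"
    using measurable_compose[OF X_measurable[OF assms(1)] assms(2)] .
  ultimately show ?thesis unfolding transition_semigroup_def[abs_def]
    using integral_measurable_subprob_algebra measurable_compose by blast
qed

text \<open>The expectation of the Markov property.\<close>

lemma semigroup_add:
  fixes f :: "'e \<Rightarrow> real"
  assumes "0 \<le> s" "0 \<le> t" "f \<in> borel_measurable borel" "bounded (range f)"
  shows "transition_semigroup P X (s + t) f = transition_semigroup P X s (transition_semigroup P X t f)"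
proof
  fix x
  interpret prob_space "P x" by (rule prob_space_P)
  let ?G = "{X u -` A \<inter> space (P x) | u A. 0 \<le> u \<and> u \<le> s \<and> A \<in> sets borel}"
  have G: "?G \<subseteq> sets (P x)"
    using X_measurable_P by (auto intro: measurable_sets)
  have "subalgebra (P x) (natural_filtration \<Omega> X s)"
    unfolding subalgebra_def natural_filtration_def space_P[of x, symmetric]
    using G sets.space_closed[of "P x"] by (auto simp: space_measure_of_conv intro: sets.sigma_sets_subset[THEN subsetD])
  then interpret sub: finite_measure_subalgebra "P x" "natural_filtration \<Omega> X s"
    by unfold_locales
  have "transition_semigroup P X (s + t) f x
      = (\<integral>\<omega>. real_cond_exp (P x) (natural_filtration \<Omega> X s) (\<lambda>\<omega>. f (X (s + t) \<omega>)) \<omega> \<partial>P x)"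
    unfolding transition_semigroup_def using assms
    by (intro sub.real_cond_exp_int(2)[symmetric] integrable_P) auto
  also have "\<dots> = (\<integral>\<omega>. transition_semigroup P X t f (X s \<omega>) \<partial>P x)"
    using assms measurable_compose[OF X_measurable_P semigroup_measurable]
    by (intro integral_cong_AE markov) (auto simp: sub.real_cond_exp_int)
  finally show "transition_semigroup P X (s + t) f x
      = transition_semigroup P X s (transition_semigroup P X t f) x"
    by (simp add: transition_semigroup_def)
qed

lemma semigroup_diff_le_coupling_distance:
  assumes "0 \<le> t" "f \<in> borel_measurable borel" "bounded (range f)" "lipschitz_bound \<rho> 1 f"
  shows "ennreal (transition_semigroup P X t f x - transition_semigroup P X t f y)
    \<le> coupling_distance \<rho> P X t x y"
  unfolding coupling_distance_def
proof (rule INF_greatest)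
  fix \<pi> assume "\<pi> \<in> couplings (law P X t x) (law P X t y)"
  moreover have "integrable (law P X t z) f" for z
    unfolding law_def using assms integrable_P[OF assms(1-3)] X_measurable_P[OF assms(1)]
    by (simp add: integrable_distr_eq)
  ultimately have "ennreal (integral\<^sup>L (law P X t x) f - integral\<^sup>L (law P X t y) f)
      \<le> (\<integral>\<^sup>+z. \<rho> (fst z) (snd z) \<partial>\<pi>)"
    using assms by (intro lipschitz_integral_diff_le_cost)
  then show "ennreal (transition_semigroup P X t f x - transition_semigroup P X t f y)
      \<le> (\<integral>\<^sup>+z. \<rho> (fst z) (snd z) \<partial>\<pi>)"
    using assms by (simp add: integral_law)
qed

lemma contracts_of_acts_as_contraction:
  assumes "acts_as_contraction \<rho> P X" "0 \<le> t"
  shows "lipschitz_contracts \<rho> P X 1 t"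
  unfolding lipschitz_contracts_def
proof (intro ballI impI)
  fix f :: "'e \<Rightarrow> real"
  assume "f \<in> borel_measurable borel" "bounded (range f)" "lipschitz_bound \<rho> 1 f"
  note le = semigroup_diff_le_coupling_distance[OF assms(2) this]
  have "coupling_distance \<rho> P X t x y \<le> \<rho> x y" for x y
    using assms by (simp add: acts_as_contraction_def)
  then show "lipschitz_bound \<rho> 1 (transition_semigroup P X t f)"
    using order_trans[OF le] by (simp add: lipschitz_bound_def)
qed

lemma contracts_add:
  assumes "lipschitz_contracts \<rho> P X r s" "lipschitz_contracts \<rho> P X u t" "0 < u" "0 \<le> s" "0 \<le> t"
  shows "lipschitz_contracts \<rho> P X (u * r) (s + t)"
  unfolding lipschitz_contracts_def
proof (intro ballI impI)
  fix f :: "'e \<Rightarrow> real"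
  assume f: "f \<in> borel_measurable borel" "bounded (range f)" "lipschitz_bound \<rho> 1 f"
  then have "lipschitz_bound \<rho> u (transition_semigroup P X t f)"
    using assms(2) by (auto simp: lipschitz_contracts_def)
  from lipschitz_contractsD[OF assms(1) semigroup_measurable[OF assms(5) f(1)]
      semigroup_bounded[OF assms(5) f(1,2)] this assms(3)]
  show "lipschitz_bound \<rho> (u * r) (transition_semigroup P X (s + t) f)"
    using semigroup_add[OF assms(4,5) f(1,2)] by simp
qed

lemma contracts_power:
  assumes "acts_as_contraction \<rho> P X" "lipschitz_contracts \<rho> P X r T" "0 < r" "0 \<le> T" "real k * T \<le> t"
  shows "lipschitz_contracts \<rho> P X (r ^ k) t"
  using assms(5)
proof (induction k arbitrary: t)
  case 0
  then show ?case using contracts_of_acts_as_contraction[OF assms(1)] by simp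
next
  case (Suc k)
  have "real k * T \<le> t - T" using Suc.prems by (simp add: algebra_simps)
  moreover have "0 \<le> real k * T" using assms by simp
  ultimately have "T \<le> t" by linarith
  then have "lipschitz_contracts \<rho> P X (r ^ k * r) (T + (t - T))"
    using \<open>real k * T \<le> t - T\<close> Suc.IH[of "t - T"] assms by (intro contracts_add) auto
  then show ?case by (simp add: mult.commute)
qed

text \<open>
  Rescaling to norm one is possible unless the norm of \<open>f\<close> is zero. In that case \<open>f\<close> is
  \<open>r\<close>-Lipschitz for every \<open>r > 0\<close>, and contraction gives the same for \<open>S\<^sub>t f\<close>.
\<close>

lemma semigroup_lip_norm_leD:
  assumes con: "acts_as_contraction \<rho> P X" and t: "0 \<le> t" and r: "0 < r"
    and le: "semigroup_lip_norm \<rho> P X t \<le> ennreal r"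
  shows "lipschitz_contracts \<rho> P X r t"
  unfolding lipschitz_contracts_def
proof (intro ballI impI)
  fix f :: "'e \<Rightarrow> real"
  assume f: "f \<in> borel_measurable borel" "bounded (range f)" "lipschitz_bound \<rho> 1 f"
  have "lip_norm \<rho> f \<le> 1" using lip_norm_leI[OF f(3)] by simp
  then obtain l where l: "lip_norm \<rho> f = ennreal l" "0 \<le> l" "l \<le> 1"
    by (cases "lip_norm \<rho> f") (auto simp: top_unique)
  show "lipschitz_bound \<rho> r (transition_semigroup P X t f)"
  proof (cases "l = 0")
    case True
    then have "lipschitz_bound \<rho> r f" using l r by (intro lip_norm_leD) auto
    from lipschitz_contractsD[OF contracts_of_acts_as_contraction[OF con t] f(1,2) this r] show ?thesis by simp
  next
    case False
    then have l0: "0 < l" using l by simp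
    define g where "g = (\<lambda>x. (1 / l) * f x)"
    have "lipschitz_bound \<rho> l f" using l l0 by (intro lip_norm_leD) auto
    from lipschitz_bound_scale[OF this, of "1 / l"] have "lipschitz_bound \<rho> 1 g"
      using l0 by (simp add: g_def)
    then have "lip_norm \<rho> g \<le> 1" using lip_norm_leI[of \<rho> 1 g] by simp
    moreover have "1 \<le> lip_norm \<rho> g"
    proof (rule ccontr)
      assume "\<not> 1 \<le> lip_norm \<rho> g"
      then obtain s where s: "lip_norm \<rho> g < s" "s < 1" using dense[of "lip_norm \<rho> g" 1] by (auto simp: not_le)
      then obtain s' where s': "s = ennreal s'" "0 \<le> s'" by (cases s) auto
      then have "0 < s'" "s' < 1" using s by (auto simp: zero_less_iff_neq_zero intro: le_neq_trans)
      then have "lipschitz_bound \<rho> s' g" using s s' by (intro lip_norm_leD) auto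
      from lipschitz_bound_scale[OF this, of l] have "lipschitz_bound \<rho> (l * s') f"
        using l0 by (simp add: g_def)
      then have "ennreal l \<le> ennreal (l * s')" using lip_norm_leI l s' by fastforce
      then show False using l0 \<open>s' < 1\<close> \<open>0 < s'\<close> by (simp add: ennreal_le_iff)
    qed
    ultimately have g1: "lip_norm \<rho> g = 1" by simp
    have g: "g \<in> borel_measurable borel" "bounded (range g)"
      using f bounded_scaling[OF f(2), of "1 / l"] by (auto simp: g_def image_image)
    have "lip_norm \<rho> (transition_semigroup P X t g) \<le> semigroup_lip_norm \<rho> P X t"
      unfolding semigroup_lip_norm_def using g g1 integrable_P[OF t g] by (intro Sup_upper) auto
    then have "lipschitz_bound \<rho> r (transition_semigroup P X t g)"
      using le r by (intro lip_norm_leD) auto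
    from lipschitz_bound_scale[OF this, of l] have "lipschitz_bound \<rho> (l * r) (transition_semigroup P X t f)"
      using l0 by (simp add: g_def transition_semigroup_def[abs_def])
    then show ?thesis by (rule lipschitz_bound_mono) (use l r in \<open>simp add: mult_left_le_one_le\<close>)
  qed
qed

lemma truncation_lipschitz:
  fixes f :: "'e \<Rightarrow> real"
  assumes "lipschitz_bound \<rho> 1 f"
  shows "lipschitz_bound \<rho> 1 (\<lambda>x. max (- real n) (min (real n) (f x)))"
  unfolding lipschitz_bound_def
proof safe
  fix x y
  have "ennreal (max (- real n) (min (real n) (f x)) - max (- real n) (min (real n) (f y))) \<le> ennreal (f x - f y)"
    by (cases "f x \<le> f y") (auto intro!: ennreal_leI simp: ennreal_neg)
  also have "\<dots> \<le> ennreal 1 * \<rho> x y" by (rule lipschitz_boundD[OF assms])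
  finally show "ennreal (max (- real n) (min (real n) (f x)) - max (- real n) (min (real n) (f y))) \<le> ennreal 1 * \<rho> x y" .
qed

text \<open>
  Truncation at \<open>\<plusminus>n\<close> preserves the Lipschitz bound, and dominated convergence passes it from the
  truncated functions to an integrable \<open>f\<close>.
\<close>

lemma semigroup_lip_norm_leI:
  assumes c: "lipschitz_contracts \<rho> P X r t" and t: "0 \<le> t" and r: "0 \<le> r"
  shows "semigroup_lip_norm \<rho> P X t \<le> ennreal r"
  unfolding semigroup_lip_norm_def
proof (rule Sup_least, safe)
  fix f :: "'e \<Rightarrow> real"
  assume f: "f \<in> borel_measurable borel" "\<forall>x. integrable (P x) (\<lambda>\<omega>. f (X t \<omega>))" "lip_norm \<rho> f = 1"
  define g where "g = (\<lambda>n x. max (- real n) (min (real n) (f x)))"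
  have f1: "lipschitz_bound \<rho> 1 f" using f(3) by (intro lip_norm_leD) auto
  have g: "g n \<in> borel_measurable borel" "bounded (range (g n))" "lipschitz_bound \<rho> 1 (g n)" for n
    using f(1) truncation_lipschitz[OF f1] by (auto simp: g_def bounded_iff intro!: exI[of _ "real n"])
  have gr: "lipschitz_bound \<rho> r (transition_semigroup P X t (g n))" for n
    using c g by (auto simp: lipschitz_contracts_def)
  have lim: "(\<lambda>n. transition_semigroup P X t (g n) x) \<longlonglongrightarrow> transition_semigroup P X t f x" for x
    unfolding transition_semigroup_def
  proof (rule integral_dominated_convergence[where w = "\<lambda>\<omega>. norm (f (X t \<omega>))"])
    show "(\<lambda>\<omega>. f (X t \<omega>)) \<in> borel_measurable (P x)" "(\<lambda>\<omega>. g n (X t \<omega>)) \<in> borel_measurable (P x)" for n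
      using measurable_compose[OF X_measurable_P[OF t]] f(1) g(1) by auto
    show "integrable (P x) (\<lambda>\<omega>. norm (f (X t \<omega>)))" using f(2) by simp
    show "AE \<omega> in P x. norm (g n (X t \<omega>)) \<le> norm (f (X t \<omega>))" for n
      by (rule AE_I2) (auto simp: g_def)
    have "(\<lambda>n. g n z) \<longlonglongrightarrow> f z" for z
    proof (rule tendsto_eventually)
      obtain N where "\<bar>f z\<bar> \<le> real N" using real_arch_simple by blast
      then have "g n z = f z" if "N \<le> n" for n
        using that of_nat_mono[OF that, where 'a = real] by (auto simp: g_def)
      then show "eventually (\<lambda>n. g n z = f z) sequentially" by (auto simp: eventually_sequentially)
    qed
    then show "AE \<omega> in P x. (\<lambda>n. g n (X t \<omega>)) \<longlonglongrightarrow> f (X t \<omega>)" by simp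
  qed
  have "lipschitz_bound \<rho> r (transition_semigroup P X t f)"
    unfolding lipschitz_bound_def
  proof safe
    fix x y
    have "(\<lambda>n. ennreal (transition_semigroup P X t (g n) x - transition_semigroup P X t (g n) y))
        \<longlonglongrightarrow> ennreal (transition_semigroup P X t f x - transition_semigroup P X t f y)"
      by (intro tendsto_ennrealI tendsto_diff lim)
    then show "ennreal (transition_semigroup P X t f x - transition_semigroup P X t f y) \<le> ennreal r * \<rho> x y"
      by (rule LIMSEQ_le_const2) (use gr in \<open>auto simp: lipschitz_bound_def\<close>)
  qed
  then show "lip_norm \<rho> (transition_semigroup P X t f) \<le> ennreal r" using r by (rule lip_norm_leI)
qed

text \<open>
  The difference \<open>S\<^sub>t f(x) - S\<^sub>t f(y)\<close> bounds \<open>\<rho>\<^sub>s(x,y)\<close> from below for every \<open>s \<le> t\<close>, because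
  \<open>S\<^sub>t f = S\<^sub>s (S\<^sub>t\<^sub>-\<^sub>s f)\<close> and \<open>S\<^sub>t\<^sub>-\<^sub>s f\<close> is still \<open>1\<close>-Lipschitz. Integrating this constant lower bound
  over \<open>s \<in> [0,t]\<close> produces the factor \<open>t\<close>.
\<close>

lemma contracts_of_coupling_time_bound:
  assumes con: "acts_as_contraction \<rho> P X" and t: "0 < t" and M: "0 < M"
    and h: "\<And>x y. generalized_coupling_time \<rho> P X x y \<le> ennreal M * \<rho> x y"
  shows "lipschitz_contracts \<rho> P X (M / t) t"
  unfolding lipschitz_contracts_def
proof (intro ballI impI)
  fix f :: "'e \<Rightarrow> real"
  assume f: "f \<in> borel_measurable borel" "bounded (range f)" "lipschitz_bound \<rho> 1 f"
  show "lipschitz_bound \<rho> (M / t) (transition_semigroup P X t f)"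
    unfolding lipschitz_bound_def
  proof safe
    fix x y
    define d where "d = ennreal (transition_semigroup P X t f x - transition_semigroup P X t f y)"
    have d_le: "d \<le> coupling_distance \<rho> P X s x y" if s: "0 \<le> s" "s \<le> t" for s
    proof -
      let ?g = "transition_semigroup P X (t - s) f"
      have "transition_semigroup P X t f = transition_semigroup P X s ?g"
        using semigroup_add[of s "t - s" f] f s by simp
      moreover have "lipschitz_bound \<rho> 1 ?g"
        using contracts_of_acts_as_contraction[OF con, of "t - s"] f s by (simp add: lipschitz_contracts_def)
      ultimately show ?thesis
        unfolding d_def using s f semigroup_measurable semigroup_bounded
        by (auto intro!: semigroup_diff_le_coupling_distance)
    qed
    have "ennreal t * d = (\<integral>\<^sup>+s. d * indicator {0..t} s \<partial>lborel)"
      using t by (simp add: nn_integral_cmult mult.commute)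
    also have "\<dots> \<le> generalized_coupling_time \<rho> P X x y"
      unfolding generalized_coupling_time_def using d_le
      by (intro nn_integral_mono) (auto simp: indicator_def)
    also have "\<dots> \<le> ennreal M * \<rho> x y" by (rule h)
    finally have "ennreal (1 / t) * (ennreal t * d) \<le> ennreal (1 / t) * (ennreal M * \<rho> x y)"
      by (intro mult_left_mono) auto
    then show "ennreal (transition_semigroup P X t f x - transition_semigroup P X t f y) \<le> ennreal (M / t) * \<rho> x y"
      using t M by (simp add: d_def mult.assoc[symmetric] ennreal_mult[symmetric])
  qed
qed

end

section \<open>Coupling time and contraction\<close>

context feller_process
begin

text \<open>
  The test functions for the laws at time \<open>t\<close> started from \<open>x\<close> and \<open>y\<close> satisfy
  \<open>S\<^sub>t f(x) - S\<^sub>t f(y) \<le> r \<rho>(x,y)\<close>, so duality applies with \<open>L = r \<rho>(x,y)\<close> whenever this is finite.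
\<close>

lemma coupling_distance_le_of_contracts:
  assumes lsc: "lower_semicontinuous (\<lambda>(x, y). \<rho> x y)" and semi: "ext_semimetric \<rho>"
    and c: "lipschitz_contracts \<rho> P X r t" and r: "0 < r" and t: "0 \<le> t"
  shows "coupling_distance \<rho> P X t x y \<le> ennreal r * \<rho> x y"
proof (cases "\<rho> x y")
  case top
  then show ?thesis using r by (simp add: ennreal_mult_top)
next
  case (real d)
  have law: "prob_space (law P X t z)" "sets (law P X t z) = sets borel" for z
    unfolding law_def using prob_space.prob_space_distr[OF prob_space_P X_measurable_P[OF t]] by auto
  have "\<exists>\<pi>\<in>couplings (law P X t x) (law P X t y). (\<integral>\<^sup>+z. \<rho> (fst z) (snd z) \<partial>\<pi>) \<le> ennreal (r * d)"
  proof (rule kantorovich_rubinstein_coupling[OF lsc semi law law])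
    fix f :: "'e \<Rightarrow> real"
    assume f: "f \<in> borel_measurable borel" "bounded (range f)" "\<And>x y. ennreal (f x - f y) \<le> \<rho> x y"
    then have "lipschitz_bound \<rho> r (transition_semigroup P X t f)"
      using c by (auto simp: lipschitz_contracts_def lipschitz_bound_def)
    then have "ennreal (transition_semigroup P X t f x - transition_semigroup P X t f y) \<le> ennreal (r * d)"
      using lipschitz_boundD[of \<rho> r _ x y] real by (simp add: ennreal_mult'')
    then show "integral\<^sup>L (law P X t x) f - integral\<^sup>L (law P X t y) f \<le> r * d"
      using r real t f(1) by (simp add: ennreal_le_iff integral_law)
  qed
  then show ?thesis
    unfolding coupling_distance_def using real by (auto simp: ennreal_mult'' intro: INF_lower2)
qed

text \<open>
  On \<open>[k T, (k + 1) T)\<close> the coupling distance is at most \<open>\<alpha>\<^sup>-\<^sup>k \<rho>\<close>; the time integral is bounded by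
  the resulting geometric series.
\<close>

lemma coupling_time_le_of_contracts:
  assumes lsc: "lower_semicontinuous (\<lambda>(x, y). \<rho> x y)" and semi: "ext_semimetric \<rho>"
    and con: "acts_as_contraction \<rho> P X" and \<alpha>: "1 < \<alpha>" and T: "0 < T"
    and c: "lipschitz_contracts \<rho> P X (1 / \<alpha>) T"
  shows "generalized_coupling_time \<rho> P X x y \<le> ennreal (\<alpha> * T / (\<alpha> - 1)) * \<rho> x y"
proof -
  define g where "g = (\<lambda>k t. ennreal ((1 / \<alpha>) ^ k) * \<rho> x y * indicator {real k * T..<real (Suc k) * T} t)"
  have le: "coupling_distance \<rho> P X t x y * indicator {0..} t \<le> (\<Sum>k. g k t)" for t
  proof (cases "0 \<le> t")
    case True
    define k where "k = nat \<lfloor>t / T\<rfloor>"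
    have "real k = of_int \<lfloor>t / T\<rfloor>" using True T by (simp add: k_def)
    then have "real k \<le> t / T" "t / T < real k + 1" by linarith+
    then have k: "real k * T \<le> t" "t < real (Suc k) * T" using T by (simp_all add: field_simps)
    have "lipschitz_contracts \<rho> P X ((1 / \<alpha>) ^ k) t"
      using \<alpha> T k by (intro contracts_power[OF con c]) auto
    then have "coupling_distance \<rho> P X t x y \<le> ennreal ((1 / \<alpha>) ^ k) * \<rho> x y"
      using \<alpha> True by (intro coupling_distance_le_of_contracts[OF lsc semi]) auto
    then have "coupling_distance \<rho> P X t x y * indicator {0..} t \<le> g k t"
      using True k by (simp add: g_def)
    also have "\<dots> \<le> (\<Sum>k. g k t)"
      using sum_le_suminf[of "\<lambda>k. g k t" "{k}"] by simp
    finally show ?thesis .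
  qed simp
  have "generalized_coupling_time \<rho> P X x y \<le> (\<integral>\<^sup>+t. (\<Sum>k. g k t) \<partial>lborel)"
    unfolding generalized_coupling_time_def using le by (intro nn_integral_mono)
  also have "\<dots> = (\<Sum>k. \<integral>\<^sup>+t. g k t \<partial>lborel)"
    by (rule nn_integral_suminf) (simp add: g_def)
  also have "\<dots> = (\<Sum>k. ennreal ((1 / \<alpha>) ^ k) * (\<rho> x y * ennreal T))"
  proof (rule suminf_cong)
    fix k
    have "emeasure lborel {real k * T..<real (Suc k) * T} = ennreal T"
      using T by (simp add: algebra_simps)
    then show "(\<integral>\<^sup>+t. g k t \<partial>lborel) = ennreal ((1 / \<alpha>) ^ k) * (\<rho> x y * ennreal T)"
      unfolding g_def by (subst nn_integral_cmult_indicator) (auto simp: mult.assoc)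
  qed
  also have "\<dots> = (\<Sum>k. ennreal ((1 / \<alpha>) ^ k)) * (\<rho> x y * ennreal T)" by simp
  also have "(\<Sum>k. ennreal ((1 / \<alpha>) ^ k)) = ennreal (1 / (1 - 1 / \<alpha>))"
    using \<alpha> by (subst suminf_ennreal2) (auto intro: summable_geometric simp: suminf_geometric)
  also have "ennreal (1 / (1 - 1 / \<alpha>)) * (\<rho> x y * ennreal T) = ennreal (1 / (1 - 1 / \<alpha>) * T) * \<rho> x y"
    using \<alpha> T by (subst ennreal_mult) (auto simp: ac_simps)
  also have "1 / (1 - 1 / \<alpha>) * T = \<alpha> * T / (\<alpha> - 1)"
    using \<alpha> by (simp add: field_simps)
  finally show ?thesis .
qed

end

theorem theorem3p9:
  fixes \<Omega> :: "'w measure"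
    and P :: "'e::polish_space \<Rightarrow> 'w measure"
    and X :: "real \<Rightarrow> 'w \<Rightarrow> 'e"
    and \<rho> :: "'e \<Rightarrow> 'e \<Rightarrow> ennreal"
  assumes "feller_process \<Omega> P X"
    and "lower_semicontinuous (\<lambda>(x, y). \<rho> x y)"
    and "ext_metric \<rho>"
    and "acts_as_contraction \<rho> P X"
  shows "((\<exists>M>0. \<forall>x y. generalized_coupling_time \<rho> P X x y \<le> ennreal M * \<rho> x y)
            \<longleftrightarrow> exponentially_contracting \<rho> P X)
    \<and> (\<forall>\<alpha>>1. \<forall>M>0.
          (\<forall>x y. generalized_coupling_time \<rho> P X x y \<le> ennreal M * \<rho> x y)
          \<longrightarrow> (\<forall>t\<ge>M * \<alpha>. semigroup_lip_norm \<rho> P X t \<le> ennreal (1 / \<alpha>)))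
    \<and> (\<forall>\<alpha>>1. \<forall>T>0.
          semigroup_lip_norm \<rho> P X T \<le> ennreal (1 / \<alpha>)
          \<longrightarrow> (\<forall>x y. generalized_coupling_time \<rho> P X x y \<le> ennreal (\<alpha> * T / (\<alpha> - 1)) * \<rho> x y))"
proof -
  interpret feller_process \<Omega> P X by fact
  note lsc = assms(2) and con = assms(4)
  have semi: "ext_semimetric \<rho>" using assms(3) by (simp add: ext_metric_def)
  have a: "semigroup_lip_norm \<rho> P X t \<le> ennreal (1 / \<alpha>)"
    if \<alpha>: "1 < \<alpha>" and M: "0 < M" and t: "M * \<alpha> \<le> t"
      and h: "\<forall>x y. generalized_coupling_time \<rho> P X x y \<le> ennreal M * \<rho> x y" for \<alpha> M t
  proof -
    have t0: "0 < t" using \<alpha> M t by (intro less_le_trans[OF _ t]) simp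
    have "lipschitz_contracts \<rho> P X (M / t) t"
      using contracts_of_coupling_time_bound[OF con t0 M] h by blast
    then have "semigroup_lip_norm \<rho> P X t \<le> ennreal (M / t)"
      using t0 M by (intro semigroup_lip_norm_leI) auto
    also have "\<dots> \<le> ennreal (1 / \<alpha>)"
      using t0 M \<alpha> t by (intro ennreal_leI) (simp add: field_simps)
    finally show ?thesis .
  qed
  have b: "generalized_coupling_time \<rho> P X x y \<le> ennreal (\<alpha> * T / (\<alpha> - 1)) * \<rho> x y"
    if \<alpha>: "1 < \<alpha>" and T: "0 < T" and le: "semigroup_lip_norm \<rho> P X T \<le> ennreal (1 / \<alpha>)" for \<alpha> T x y
    using \<alpha> T semigroup_lip_norm_leD[OF con _ _ le]
    by (intro coupling_time_le_of_contracts[OF lsc semi con]) auto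
  have "exponentially_contracting \<rho> P X"
    if M: "0 < M" and h: "\<forall>x y. generalized_coupling_time \<rho> P X x y \<le> ennreal M * \<rho> x y" for M
    unfolding exponentially_contracting_def
  proof (intro exI conjI allI impI)
    show "(2::real) > 0" "ln 2 / (2 * M) > 0" using M by auto
    fix t :: real assume t: "0 \<le> t"
    have half: "lipschitz_contracts \<rho> P X (1 / 2) (2 * M)"
      using contracts_of_coupling_time_bound[OF con _ M, of "2 * M"] h M by simp
    define k where "k = nat \<lfloor>t / (2 * M)\<rfloor>"
    have "real k = of_int \<lfloor>t / (2 * M)\<rfloor>" using t M by (simp add: k_def)
    then have k: "real k \<le> t / (2 * M)" "t / (2 * M) < real k + 1" by linarith+
    have "lipschitz_contracts \<rho> P X ((1 / 2) ^ k) t"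
      using k(1) M by (intro contracts_power[OF con half]) (auto simp: field_simps)
    then have "semigroup_lip_norm \<rho> P X t \<le> ennreal ((1 / 2) ^ k)"
      using t by (intro semigroup_lip_norm_leI) auto
    also have "(1 / 2) ^ k \<le> 2 * exp (- (ln 2 / (2 * M)) * t)"
    proof -
      have "(1 / 2) ^ k = exp (- real k * ln 2)"
        by (simp add: exp_minus exp_of_nat_mult power_one_over inverse_eq_divide)
      also have "\<dots> \<le> exp (ln 2 - t / (2 * M) * ln 2)"
        using mult_right_mono[OF less_imp_le[OF k(2)], of "ln 2"] by (simp add: algebra_simps)
      also have "\<dots> = 2 * exp (- (ln 2 / (2 * M)) * t)"
        by (simp add: exp_diff exp_minus field_simps)
      finally show ?thesis .
    qed
    finally show "semigroup_lip_norm \<rho> P X t \<le> ennreal (2 * exp (- (ln 2 / (2 * M)) * t))"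
      by (simp add: ennreal_leI)
  qed
  moreover have "\<exists>M>0. \<forall>x y. generalized_coupling_time \<rho> P X x y \<le> ennreal M * \<rho> x y"
    if "exponentially_contracting \<rho> P X"
  proof -
    from that obtain C c where Cc: "0 < C" "0 < c"
      and le: "\<And>t. 0 \<le> t \<Longrightarrow> semigroup_lip_norm \<rho> P X t \<le> ennreal (C * exp (- c * t))"
      by (auto simp: exponentially_contracting_def)
    define T where "T = max 1 (ln (2 * C) / c)"
    have T: "0 < T" by (simp add: T_def)
    have "ln (2 * C) / c \<le> T" by (simp add: T_def)
    then have "ln (2 * C) \<le> c * T" using Cc by (simp add: field_simps)
    then have "exp (- c * T) \<le> exp (- ln (2 * C))" by simp
    also have "\<dots> = 1 / (2 * C)" using Cc by (simp add: exp_minus inverse_eq_divide)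
    finally have "C * exp (- c * T) \<le> 1 / 2" using Cc by (simp add: field_simps)
    then have "semigroup_lip_norm \<rho> P X T \<le> ennreal (1 / 2)"
      using le[of T] T by (meson ennreal_leI less_imp_le order_trans)
    then have "generalized_coupling_time \<rho> P X x y \<le> ennreal (2 * T / (2 - 1)) * \<rho> x y" for x y
      using b[of 2 T] T by simp
    then show ?thesis using T by (intro exI[of _ "2 * T"]) auto
  qed
  ultimately show ?thesis using a b by blast
qed

end
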